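(* Let $(X,\omega)$ be a symplectic manifold of dimension $2n$ with a Fedosov connection $D$ and associated star product $\star$, and let $U\subset X$ be a quantum Darboux chart. Then the quantum polynomials, and the quantizable functions, on $U$ are dense in $C^\infty(U)[[\hbar]]$ in the following sense: for every $f\in C^\infty(U)[[\hbar]]$, every compact subset $K\subset U$ and every $\epsilon>0$, there exists a quantum polynomial $p$ (which is in particular a quantizable function) such that $$d_K(f,p)<\epsilon .$$
   Context: Functions are real- or complex-valued (one choice of scalars is fixed); $\hbar$ is a formal variable. Weyl bundle. $\mathcal{W}=\widehat{\mathrm{Sym}}\,T^*X$ is the completed symmetric algebra bundle of $T^*X$; in local coordinates $(x^1,\dots,x^{2n})$ its sections are formal power series in generators $y^1,\dots,y^{2n}$ ($y^i$ corresponding to $dx^i$) with smooth coefficients. Let $\omega^{ij}$ be the coefficients of the Poisson tensor, $\{f,g\}=\omega^{ij}\partial_if\,\partial_jg$. The fiberwise Moyal–Weyl product on $\mathcal{W}[[\hbar]]$ is $(\alpha\star_{MW}\beta)(y,\hbar)=\exp\big(\frac{\hbar}{2}\omega^{ij}\frac{\partial}{\partial u^i}\frac{\partial}{\partial v^j}\big)\alpha(u,\hbar)\beta(v,\hbar)\big|_{u=v=y}$, extended to $\mathcal{W}[[\hbar]]$-valued differential forms; $[-,-]_{\star_{MW}}$ is its graded commutator. Weights: $|\hbar|=2$, $|y^i|=1$. Put $\delta a=dx^i\wedge\frac{\partial a}{\partial y^i}$. Fedosov connection. A flat connection $D=\nabla-\delta+\frac1\hbar[I,-]_{\star_{MW}}$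 on $\mathcal{W}[[\hbar]]$, where $\nabla$ is induced by a torsion-free symplectic connection on $X$ and $I$ is a $\mathcal{W}[[\hbar]]$-valued $1$-form all of whose terms have weight $\ge 3$. The symbol map $\sigma$ (setting all $y^i=0$) is a bijection from $D$-flat sections of $\mathcal{W}[[\hbar]]$ to formal smooth functions (also over open subsets); $O_f$ denotes the flat section with $\sigma(O_f)=f$. The associated star product is $f\star g=\sigma(O_f\star_{MW}O_g)$. Quantum Darboux chart. An open $U\subset X$ with Darboux coordinates $(x^1,\dots,x^{2n})$, $\omega=\sum_{i=1}^n dx^{2i-1}\wedge dx^{2i}$, in which $D|_U=d-\delta=\sum_{i=1}^{2n}dx^i\big(\frac{\partial}{\partial x^i}-\frac{\partial}{\partial y^i}\big)$. On such a chart $O_{x^i}=x^i+y^i$, and $\star$ is the Moyal–Weyl product $f\star g=\exp\big(\frac{\hbar}{2}\omega^{ij}\partial_{u^i}\partial_{v^j}\big)f(u)g(v)|_{u=v=x}$ with constant $\omega^{ij}$. Quantum polynomials on $U$: elements of the (unital) algebra generated by the coordinate functions $x^1,\dots,x^{2n}$ under $\star$. Quantizable functions: formal smooth functions $f$ such that $O_f$ has only finitely many nonzero weight components. Metric $d_K$. For $K\subset U$ compact and $g\in C^\infty(U)$ put $\|g\|_{K,l}=\sup\{|\partial^{|I|}g/\partial x^I(x_0)|: x_0\in K,\ |I|\le l\}$ (derivatives in the Darboux coordinates). For $f=\sum_i\hbar^if_i\in C^\infty(U)[[\hbar]]$ put $\|f\|_{K,\hbar,k}=\sum_{i+j=k}\|f_i\|_{K,j}$,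 and $$d_K(f,g)=\sum_{k=0}^\infty 2^{-k}\frac{\|f-g\|_{K,\hbar,k}}{1+\|f-g\|_{K,\hbar,k}}.$$ *)

theory Defs
  imports "HOL-Analysis.Analysis" "HOL-Library.Multiset"
begin

section \<open>Smooth manifolds\<close>

text \<open>
  A chart is a pair of its domain and its coordinate map; the values of the coordinate map off the
  domain carry no meaning.  All objects on a manifold (functions, tensor components, sections) are
  functions of the point, and partial derivatives are taken through the inverse of the
  coordinate map.
\<close>

type_synonym ('x, 'm) chart = "'x set \<times> ('x \<Rightarrow> real ^ 'm)"

abbreviation chart_dom :: "('x, 'm) chart \<Rightarrow> 'x set" where
  "chart_dom c \<equiv> fst c"

abbreviation chart_map :: "('x, 'm) chart \<Rightarrow> 'x \<Rightarrow> real ^ 'm" where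
  "chart_map c \<equiv> snd c"

abbreviation chart_inv :: "('x, 'm) chart \<Rightarrow> real ^ 'm \<Rightarrow> 'x" where
  "chart_inv c \<equiv> inv_into (chart_dom c) (chart_map c)"

definition is_chart :: "('x::topological_space, 'm::finite) chart \<Rightarrow> bool" where
  "is_chart c \<longleftrightarrow> open (chart_dom c) \<and> open (chart_map c ` chart_dom c) \<and>
     homeomorphism (chart_dom c) (chart_map c ` chart_dom c) (chart_map c) (chart_inv c)"

definition chart_deriv ::
    "('x, 'm::finite) chart \<Rightarrow> 'm \<Rightarrow> ('x \<Rightarrow> 'v::real_normed_vector) \<Rightarrow> 'x \<Rightarrow> 'v" where
  "chart_deriv c i g p = frechet_derivative (g \<circ> chart_inv c) (at (chart_map c p)) (axis i 1)"

text \<open>A multi-index is given as the list of the directions of differentiation.\<close>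

definition chart_derivs ::
    "('x, 'm::finite) chart \<Rightarrow> 'm list \<Rightarrow> ('x \<Rightarrow> 'v::real_normed_vector) \<Rightarrow> 'x \<Rightarrow> 'v" where
  "chart_derivs c is g = foldr (chart_deriv c) is g"

text \<open>Here \<open>S\<close> is an open subset of the chart domain.\<close>

definition smooth_in ::
    "('x, 'm::finite) chart \<Rightarrow> 'x set \<Rightarrow> ('x \<Rightarrow> 'v::real_normed_vector) \<Rightarrow> bool" where
  "smooth_in c S g \<longleftrightarrow>
     (\<forall>is. \<forall>p\<in>S. (chart_derivs c is g \<circ> chart_inv c) differentiable (at (chart_map c p)))"

definition compatible :: "('x, 'm::finite) chart \<Rightarrow> ('x, 'm) chart \<Rightarrow> bool" where
  "compatible c c' \<longleftrightarrow>
     smooth_in c (chart_dom c \<inter> chart_dom c') (chart_map c') \<and>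
     smooth_in c' (chart_dom c \<inter> chart_dom c') (chart_map c)"

definition smooth_structure :: "('x::topological_space, 'm::finite) chart set \<Rightarrow> bool" where
  "smooth_structure \<A> \<longleftrightarrow>
     (\<forall>c\<in>\<A>. is_chart c) \<and>
     (\<Union>c\<in>\<A>. chart_dom c) = UNIV \<and>
     (\<forall>c\<in>\<A>. \<forall>c'\<in>\<A>. compatible c c') \<and>
     (\<forall>c. is_chart c \<and> (\<forall>c'\<in>\<A>. compatible c c') \<longrightarrow> c \<in> \<A>)"

text \<open>The matrix of \<open>\<partial>x\<^sub>c\<^sup>i / \<partial>x\<^sub>c\<^sub>'\<^sup>j\<close>.\<close>

definition jacobian ::
    "('x, 'm::finite) chart \<Rightarrow> ('x, 'm) chart \<Rightarrow> 'x \<Rightarrow> real ^ 'm ^ 'm" where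
  "jacobian c c' p = (\<chi> i j. chart_deriv c' j (\<lambda>q. chart_map c q $ i) p)"


section \<open>Symplectic manifolds and symplectic connections\<close>

text \<open>
  Tensor fields are given by their components in every chart.  The matrix \<open>\<omega> c p\<close> holds the
  components \<open>\<omega>\<^sub>i\<^sub>j\<close> of \<open>\<omega> = 1/2 \<Sum> \<omega>\<^sub>i\<^sub>j dx\<^sup>i \<and> dx\<^sup>j\<close>.
\<close>

type_synonym ('x, 'm) two_form = "('x, 'm) chart \<Rightarrow> 'x \<Rightarrow> real ^ 'm ^ 'm"

definition symplectic_manifold ::
    "('x::topological_space, 'm::finite) chart set \<Rightarrow> ('x, 'm) two_form \<Rightarrow> bool" where
  "symplectic_manifold \<A> \<omega> \<longleftrightarrow>
     smooth_structure \<A> \<and>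
     (\<forall>c\<in>\<A>. smooth_in c (chart_dom c) (\<omega> c)) \<and>
     (\<forall>c\<in>\<A>. \<forall>c'\<in>\<A>. \<forall>p\<in>chart_dom c \<inter> chart_dom c'.
        \<omega> c' p = transpose (jacobian c c' p) ** \<omega> c p ** jacobian c c' p) \<and>
     (\<forall>c\<in>\<A>. \<forall>p\<in>chart_dom c. transpose (\<omega> c p) = - \<omega> c p \<and> invertible (\<omega> c p)) \<and>
     (\<forall>c\<in>\<A>. \<forall>p\<in>chart_dom c. \<forall>i j k.
        chart_deriv c i (\<lambda>q. \<omega> c q $ j $ k) p + chart_deriv c j (\<lambda>q. \<omega> c q $ k $ i) p
          + chart_deriv c k (\<lambda>q. \<omega> c q $ i $ j) p = 0)"

text \<open>
  The Poisson tensor is normalised by \<open>\<omega>\<^sup>i\<^sup>j \<omega>\<^sub>k\<^sub>j = \<delta>\<^sup>i\<^sub>k\<close>, i.e. \<open>{f,g} = \<omega>(X\<^sub>f, X\<^sub>g)\<close>; for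
  \<open>\<omega> = dx\<^sup>1 \<and> dx\<^sup>2\<close> this gives \<open>{x\<^sup>1, x\<^sup>2} = 1\<close>.
\<close>

definition poisson :: "('x, 'm::finite) two_form \<Rightarrow> ('x, 'm) chart \<Rightarrow> 'x \<Rightarrow> real ^ 'm ^ 'm" where
  "poisson \<omega> c p = transpose (matrix_inv (\<omega> c p))"

text \<open>\<open>\<Gamma> c p k i j\<close> is the Christoffel symbol \<open>\<Gamma>\<^sup>k\<^sub>i\<^sub>j\<close>, with \<open>\<nabla>\<^sub>i \<partial>\<^sub>j = \<Gamma>\<^sup>k\<^sub>i\<^sub>j \<partial>\<^sub>k\<close>.\<close>

type_synonym ('x, 'm) christoffel = "('x, 'm) chart \<Rightarrow> 'x \<Rightarrow> 'm \<Rightarrow> 'm \<Rightarrow> 'm \<Rightarrow> real"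

definition symplectic_connection ::
    "('x::topological_space, 'm::finite) chart set \<Rightarrow> ('x, 'm) two_form \<Rightarrow> ('x, 'm) christoffel \<Rightarrow> bool"
  where
  "symplectic_connection \<A> \<omega> \<Gamma> \<longleftrightarrow>
     (\<forall>c\<in>\<A>. \<forall>k i j. smooth_in c (chart_dom c) (\<lambda>p. \<Gamma> c p k i j)) \<and>
     (\<forall>c\<in>\<A>. \<forall>c'\<in>\<A>. \<forall>p\<in>chart_dom c \<inter> chart_dom c'. \<forall>l i j.
        (\<Sum>k\<in>UNIV. jacobian c c' p $ l $ k * \<Gamma> c' p k i j) =
        chart_deriv c' i (chart_deriv c' j (\<lambda>q. chart_map c q $ l)) p
          + (\<Sum>a\<in>UNIV. \<Sum>b\<in>UNIV.
               \<Gamma> c p l a b * jacobian c c' p $ a $ i * jacobian c c' p $ b $ j)) \<and>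
     (\<forall>c\<in>\<A>. \<forall>p\<in>chart_dom c. \<forall>k i j. \<Gamma> c p k i j = \<Gamma> c p k j i) \<and>
     (\<forall>c\<in>\<A>. \<forall>p\<in>chart_dom c. \<forall>i j k.
        chart_deriv c i (\<lambda>q. \<omega> c q $ j $ k) p =
        (\<Sum>l\<in>UNIV. \<Gamma> c p l i j * \<omega> c p $ l $ k + \<Gamma> c p l i k * \<omega> c p $ j $ l))"


section \<open>The Weyl bundle\<close>

text \<open>
  The scalars are of a type of class both \<open>real_normed_field\<close> and \<open>euclidean_space\<close>: by Frobenius'
  theorem the real and the complex numbers, up to isomorphism, and nothing else.

  An element of the fibre of \<open>\<W>[[\<hbar>]]\<close> is given in a chart by its coefficients: \<open>a h M\<close> is the
  coefficient of \<open>\<hbar>\<^sup>h y\<^sup>M\<close>, where the multiset \<open>M\<close> of indices encodes a monomial in the \<open>y\<^sup>i\<close>.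
\<close>

type_synonym ('m, 'k) sym_series = "'m multiset \<Rightarrow> 'k"
type_synonym ('m, 'k) weyl = "nat \<Rightarrow> ('m, 'k) sym_series"

definition y_deriv :: "'m \<Rightarrow> ('m, 'k::real_normed_field) sym_series \<Rightarrow> ('m, 'k) sym_series" where
  "y_deriv i a M = of_nat (Suc (count M i)) * a (add_mset i M)"

definition y_times :: "'m \<Rightarrow> ('m, 'k::real_normed_field) sym_series \<Rightarrow> ('m, 'k) sym_series" where
  "y_times i a M = (if i \<in># M then a (M - {#i#}) else 0)"

definition y_mult ::
    "('m, 'k::real_normed_field) sym_series \<Rightarrow> ('m, 'k) sym_series \<Rightarrow> ('m, 'k) sym_series" where
  "y_mult a b M = (\<Sum>N | N \<subseteq># M. a N * b (M - N))"

text \<open>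
  \<open>moyal_power P r a b\<close> is \<open>(P\<^sup>i\<^sup>j \<partial>/\<partial>u\<^sup>i \<partial>/\<partial>v\<^sup>j)\<^sup>r a(u) b(v)\<close> at \<open>u = v = y\<close>, and \<open>moyal P a b\<close> collects
  the powers of \<open>\<hbar>\<close> in \<open>exp(\<hbar>/2 P\<^sup>i\<^sup>j \<partial>/\<partial>u\<^sup>i \<partial>/\<partial>v\<^sup>j) a(u,\<hbar>) b(v,\<hbar>)\<close> at \<open>u = v = y\<close>.
\<close>

primrec moyal_power ::
    "real ^ 'm ^ 'm \<Rightarrow> nat \<Rightarrow> ('m::finite, 'k::real_normed_field) sym_series
       \<Rightarrow> ('m, 'k) sym_series \<Rightarrow> ('m, 'k) sym_series" where
  "moyal_power P 0 a b = y_mult a b"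
| "moyal_power P (Suc r) a b =
     (\<lambda>M. \<Sum>i\<in>UNIV. \<Sum>j\<in>UNIV. (P $ i $ j) *\<^sub>R moyal_power P r (y_deriv i a) (y_deriv j b) M)"

definition moyal ::
    "real ^ 'm ^ 'm \<Rightarrow> ('m::finite, 'k::real_normed_field) weyl \<Rightarrow> ('m, 'k) weyl \<Rightarrow> ('m, 'k) weyl" where
  "moyal P a b h M =
     (\<Sum>r\<le>h. \<Sum>s\<le>h - r. (1 / (2 ^ r * fact r)) *\<^sub>R moyal_power P r (a s) (b (h - r - s)) M)"

text \<open>
  \<open>(1/\<hbar>)(a \<star> b - b \<star> a)\<close>: the \<open>\<hbar>\<^sup>0\<close>-coefficient of the commutator vanishes.
\<close>

definition hbar_commutator ::
    "real ^ 'm ^ 'm \<Rightarrow> ('m::finite, 'k::real_normed_field) weyl \<Rightarrow> ('m, 'k) weyl \<Rightarrow> ('m, 'k) weyl" where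
  "hbar_commutator P a b h M = moyal P a b (Suc h) M - moyal P b a (Suc h) M"

definition weight :: "nat \<Rightarrow> 'm multiset \<Rightarrow> nat" where
  "weight h M = 2 * h + size M"

text \<open>
  Sections over the domain of a chart are total functions that vanish off the domain, so that
  equality of sections is equality of functions.
\<close>

definition weyl_sections ::
    "('x, 'm::finite) chart \<Rightarrow> ('x \<Rightarrow> ('m, 'k::real_normed_field) weyl) set" where
  "weyl_sections c =
     {a. (\<forall>h M. smooth_in c (chart_dom c) (\<lambda>p. a p h M)) \<and> (\<forall>p. p \<notin> chart_dom c \<longrightarrow> (\<forall>h M. a p h M = 0))}"

text \<open>
  \<open>taylor a [i\<^sub>1, \<dots>, i\<^sub>r]\<close> is \<open>\<partial>\<^sup>r a / \<partial>y\<^sup>i\<^sup>1 \<dots> \<partial>y\<^sup>i\<^sup>r\<close> at \<open>y = 0\<close>, i.e. the components of the symmetric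
  covariant tensors that make up \<open>a\<close>; these transform by the Jacobian.
\<close>

definition taylor :: "('m, 'k::real_normed_field) sym_series \<Rightarrow> 'm list \<Rightarrow> 'k" where
  "taylor a is = foldr y_deriv is a {#}"


section \<open>Fedosov connections\<close>

text \<open>\<open>I c p i\<close> is the coefficient of \<open>dx\<^sup>i\<close> of a \<open>\<W>[[\<hbar>]]\<close>-valued 1-form.\<close>

type_synonym ('x, 'm, 'k) weyl_form = "('x, 'm) chart \<Rightarrow> 'x \<Rightarrow> 'm \<Rightarrow> ('m, 'k) weyl"

definition weyl_one_form ::
    "('x::topological_space, 'm::finite) chart set \<Rightarrow> ('x, 'm, 'k::real_normed_field) weyl_form \<Rightarrow> bool"
  where
  "weyl_one_form \<A> I \<longleftrightarrow>
     (\<forall>c\<in>\<A>. \<forall>i h M. smooth_in c (chart_dom c) (\<lambda>p. I c p i h M)) \<and>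
     (\<forall>c\<in>\<A>. \<forall>c'\<in>\<A>. \<forall>p\<in>chart_dom c \<inter> chart_dom c'. \<forall>h j js.
        taylor (I c' p j h) js =
        (\<Sum>i\<in>UNIV. \<Sum>is | length is = length js.
           (jacobian c c' p $ i $ j * (\<Prod>s<length js. jacobian c c' p $ (is ! s) $ (js ! s)))
             *\<^sub>R taylor (I c p i h) is))"

text \<open>
  \<open>D a = \<Sum> dx\<^sup>i \<otimes> fedosov_D \<dots> a i\<close> for a section \<open>a\<close>, with
  \<open>\<nabla>\<^sub>i = \<partial>/\<partial>x\<^sup>i - \<Gamma>\<^sup>k\<^sub>i\<^sub>j y\<^sup>j \<partial>/\<partial>y\<^sup>k\<close> on the Weyl bundle.  The values are meaningful on the chart
  domain only.
\<close>

definition weyl_nabla ::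
    "('x, 'm::finite) christoffel \<Rightarrow> ('x, 'm) chart \<Rightarrow>
     ('x \<Rightarrow> ('m, 'k::real_normed_field) weyl) \<Rightarrow> 'm \<Rightarrow> 'x \<Rightarrow> ('m, 'k) weyl" where
  "weyl_nabla \<Gamma> c a i p h M =
     chart_deriv c i (\<lambda>q. a q h M) p
       - (\<Sum>k\<in>UNIV. \<Sum>j\<in>UNIV. \<Gamma> c p k i j *\<^sub>R y_times j (y_deriv k (a p h)) M)"

definition fedosov_D ::
    "('x, 'm::finite) two_form \<Rightarrow> ('x, 'm) christoffel \<Rightarrow> ('x, 'm, 'k::real_normed_field) weyl_form \<Rightarrow>
     ('x, 'm) chart \<Rightarrow> ('x \<Rightarrow> ('m, 'k) weyl) \<Rightarrow> 'm \<Rightarrow> 'x \<Rightarrow> ('m, 'k) weyl" where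
  "fedosov_D \<omega> \<Gamma> I c a i p h M =
     weyl_nabla \<Gamma> c a i p h M - y_deriv i (a p h) M
       + hbar_commutator (poisson \<omega> c p) (I c p i) (a p) h M"

text \<open>
  \<open>D b = \<Sum>\<^sub>i\<^sub><\<^sub>j dx\<^sup>i \<and> dx\<^sup>j \<otimes> fedosov_D1 \<dots> b i j\<close> for a 1-form \<open>b = \<Sum> dx\<^sup>j \<otimes> b\<^sub>j\<close>; the Christoffel terms
  acting on \<open>dx\<^sup>j\<close> cancel as \<open>\<nabla>\<close> is torsion-free.  As \<open>D \<circ> D\<close> is linear over differential forms,
  flatness is a condition on sections, and it suffices to test it on chart domains.
\<close>

definition fedosov_D1 ::
    "('x, 'm::finite) two_form \<Rightarrow> ('x, 'm) christoffel \<Rightarrow> ('x, 'm, 'k::real_normed_field) weyl_form \<Rightarrow>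
     ('x, 'm) chart \<Rightarrow> ('m \<Rightarrow> 'x \<Rightarrow> ('m, 'k) weyl) \<Rightarrow> 'm \<Rightarrow> 'm \<Rightarrow> 'x \<Rightarrow> ('m, 'k) weyl" where
  "fedosov_D1 \<omega> \<Gamma> I c b i j p h M =
     fedosov_D \<omega> \<Gamma> I c (b j) i p h M - fedosov_D \<omega> \<Gamma> I c (b i) j p h M"

definition fedosov_connection ::
    "('x::topological_space, 'm::finite) chart set \<Rightarrow> ('x, 'm) two_form \<Rightarrow> ('x, 'm) christoffel \<Rightarrow>
     ('x, 'm, 'k::real_normed_field) weyl_form \<Rightarrow> bool" where
  "fedosov_connection \<A> \<omega> \<Gamma> I \<longleftrightarrow>
     symplectic_connection \<A> \<omega> \<Gamma> \<and>
     weyl_one_form \<A> I \<and>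
     (\<forall>c\<in>\<A>. \<forall>p\<in>chart_dom c. \<forall>i h M. I c p i h M \<noteq> 0 \<longrightarrow> weight h M \<ge> 3) \<and>
     (\<forall>c\<in>\<A>. \<forall>a\<in>weyl_sections c. \<forall>i j. \<forall>p\<in>chart_dom c. \<forall>h M.
        fedosov_D1 \<omega> \<Gamma> I c (fedosov_D \<omega> \<Gamma> I c a) i j p h M = 0)"

definition flat_sections ::
    "('x, 'm::finite) two_form \<Rightarrow> ('x, 'm) christoffel \<Rightarrow> ('x, 'm, 'k::real_normed_field) weyl_form \<Rightarrow>
     ('x, 'm) chart \<Rightarrow> ('x \<Rightarrow> ('m, 'k) weyl) set" where
  "flat_sections \<omega> \<Gamma> I c =
     {a \<in> weyl_sections c. \<forall>i. \<forall>p\<in>chart_dom c. \<forall>h M. fedosov_D \<omega> \<Gamma> I c a i p h M = 0}"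


section \<open>Formal functions and the star product on a chart domain\<close>

text \<open>\<open>f k\<close> is the coefficient of \<open>\<hbar>\<^sup>k\<close>; it vanishes off the domain, as for sections.\<close>

type_synonym ('x, 'k) formal_fun = "nat \<Rightarrow> 'x \<Rightarrow> 'k"

definition formal_smooth ::
    "('x, 'm::finite) chart \<Rightarrow> ('x, 'k::real_normed_field) formal_fun set" where
  "formal_smooth c =
     {f. (\<forall>k. smooth_in c (chart_dom c) (f k)) \<and> (\<forall>k p. p \<notin> chart_dom c \<longrightarrow> f k p = 0)}"

definition symbol :: "('x \<Rightarrow> ('m, 'k::real_normed_field) weyl) \<Rightarrow> ('x, 'k) formal_fun" where
  "symbol a k p = a p k {#}"

definition flat_lift ::
    "('x, 'm::finite) two_form \<Rightarrow> ('x, 'm) christoffel \<Rightarrow> ('x, 'm, 'k::real_normed_field) weyl_form \<Rightarrow>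
     ('x, 'm) chart \<Rightarrow> ('x, 'k) formal_fun \<Rightarrow> 'x \<Rightarrow> ('m, 'k) weyl" where
  "flat_lift \<omega> \<Gamma> I c f = (THE a. a \<in> flat_sections \<omega> \<Gamma> I c \<and> symbol a = f)"

definition star ::
    "('x, 'm::finite) two_form \<Rightarrow> ('x, 'm) christoffel \<Rightarrow> ('x, 'm, 'k::real_normed_field) weyl_form \<Rightarrow>
     ('x, 'm) chart \<Rightarrow> ('x, 'k) formal_fun \<Rightarrow> ('x, 'k) formal_fun \<Rightarrow> ('x, 'k) formal_fun" where
  "star \<omega> \<Gamma> I c f g =
     symbol (\<lambda>p. moyal (poisson \<omega> c p) (flat_lift \<omega> \<Gamma> I c f p) (flat_lift \<omega> \<Gamma> I c g p))"

text \<open>A smooth function on the chart domain, as a formal function.\<close>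

definition formal_of :: "('x, 'm) chart \<Rightarrow> ('x \<Rightarrow> 'k) \<Rightarrow> ('x, 'k::real_normed_field) formal_fun" where
  "formal_of c g k p = (if k = 0 \<and> p \<in> chart_dom c then g p else 0)"

text \<open>
  The unital algebra generated by the coordinates is taken over the scalars \<open>'k\<close>.  (It contains
  \<open>\<hbar>\<close>, as a commutator of coordinates, but no infinite series in \<open>\<hbar>\<close>.)
\<close>

inductive_set quantum_polynomials ::
    "('x, 'm::finite) two_form \<Rightarrow> ('x, 'm) christoffel \<Rightarrow> ('x, 'm, 'k::real_normed_field) weyl_form \<Rightarrow>
     ('x, 'm) chart \<Rightarrow> ('x, 'k) formal_fun set"
  for \<omega> \<Gamma> I c where
  one: "formal_of c (\<lambda>_. 1) \<in> quantum_polynomials \<omega> \<Gamma> I c"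
| coord: "formal_of c (\<lambda>p. of_real (chart_map c p $ i)) \<in> quantum_polynomials \<omega> \<Gamma> I c"
| scale: "f \<in> quantum_polynomials \<omega> \<Gamma> I c \<Longrightarrow> (\<lambda>k p. s * f k p) \<in> quantum_polynomials \<omega> \<Gamma> I c"
| add: "f \<in> quantum_polynomials \<omega> \<Gamma> I c \<Longrightarrow> g \<in> quantum_polynomials \<omega> \<Gamma> I c \<Longrightarrow>
    (\<lambda>k p. f k p + g k p) \<in> quantum_polynomials \<omega> \<Gamma> I c"
| mult: "f \<in> quantum_polynomials \<omega> \<Gamma> I c \<Longrightarrow> g \<in> quantum_polynomials \<omega> \<Gamma> I c \<Longrightarrow>
    star \<omega> \<Gamma> I c f g \<in> quantum_polynomials \<omega> \<Gamma> I c"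

definition weight_component ::
    "nat \<Rightarrow> ('x \<Rightarrow> ('m, 'k::real_normed_field) weyl) \<Rightarrow> 'x \<Rightarrow> ('m, 'k) weyl" where
  "weight_component w a p h M = (if weight h M = w then a p h M else 0)"

definition quantizable_functions ::
    "('x, 'm::finite) two_form \<Rightarrow> ('x, 'm) christoffel \<Rightarrow> ('x, 'm, 'k::real_normed_field) weyl_form \<Rightarrow>
     ('x, 'm) chart \<Rightarrow> ('x, 'k) formal_fun set" where
  "quantizable_functions \<omega> \<Gamma> I c =
     {f \<in> formal_smooth c.
        finite {w. weight_component w (flat_lift \<omega> \<Gamma> I c f) \<noteq> (\<lambda>_ _ _. 0)}}"


section \<open>Quantum Darboux charts\<close>

text \<open>
  The \<open>2n\<close> coordinates are indexed by \<open>'n \<times> bool\<close> with \<open>n = CARD('n)\<close>: for the \<open>i\<close>-th element of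
  \<open>'n\<close>, the pair with \<open>False\<close> stands for the index \<open>2i - 1\<close> and the one with \<open>True\<close> for \<open>2i\<close>.
  The matrix below is that of \<open>\<Sum> dx\<^sup>2\<^sup>i\<^sup>-\<^sup>1 \<and> dx\<^sup>2\<^sup>i\<close>.
\<close>

definition darboux_form :: "real ^ ('n::finite \<times> bool) ^ ('n \<times> bool)" where
  "darboux_form =
     (\<chi> a b. if fst a = fst b \<and> snd a \<noteq> snd b then (if snd a then -1 else 1) else 0)"

definition quantum_darboux_chart ::
    "('x::topological_space, 'n::finite \<times> bool) chart set \<Rightarrow> ('x, 'n \<times> bool) two_form \<Rightarrow>
     ('x, 'n \<times> bool) christoffel \<Rightarrow> ('x, 'n \<times> bool, 'k::real_normed_field) weyl_form \<Rightarrow>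
     ('x, 'n \<times> bool) chart \<Rightarrow> bool" where
  "quantum_darboux_chart \<A> \<omega> \<Gamma> I c \<longleftrightarrow>
     c \<in> \<A> \<and>
     (\<forall>p\<in>chart_dom c. \<omega> c p = darboux_form) \<and>
     (\<forall>a\<in>weyl_sections c. \<forall>i. \<forall>p\<in>chart_dom c. \<forall>h M.
        fedosov_D \<omega> \<Gamma> I c a i p h M = chart_deriv c i (\<lambda>q. a q h M) p - y_deriv i (a p h) M)"


section \<open>The metrics \<open>d\<^sub>K\<close>\<close>

text \<open>The \<open>0\<close> inserted only makes the supremum \<open>0\<close> for empty \<open>K\<close>.\<close>

definition Ck_norm ::
    "('x, 'm::finite) chart \<Rightarrow> 'x set \<Rightarrow> nat \<Rightarrow> ('x \<Rightarrow> 'k::real_normed_field) \<Rightarrow> real" where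
  "Ck_norm c K l g = Sup (insert 0 {norm (chart_derivs c is g p) | p is. p \<in> K \<and> length is \<le> l})"

definition hbar_norm ::
    "('x, 'm::finite) chart \<Rightarrow> 'x set \<Rightarrow> nat \<Rightarrow> ('x, 'k::real_normed_field) formal_fun \<Rightarrow> real" where
  "hbar_norm c K k f = (\<Sum>i\<le>k. Ck_norm c K (k - i) (f i))"

definition dist_on ::
    "('x, 'm::finite) chart \<Rightarrow> 'x set \<Rightarrow> ('x, 'k::real_normed_field) formal_fun \<Rightarrow>
     ('x, 'k) formal_fun \<Rightarrow> real" where
  "dist_on c K f g =
     (\<Sum>k. (1 / 2) ^ k * (hbar_norm c K k (\<lambda>i p. f i p - g i p)
                            / (1 + hbar_norm c K k (\<lambda>i p. f i p - g i p))))"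

end

theory Submission
  imports Defs
begin

text \<open>
  In a quantum Darboux chart flatness for \<open>D = d - \<delta>\<close> says that the coefficient of \<open>y\<^sup>i y\<^sup>M\<close> is, up to a
  factor, the \<open>i\<close>-th derivative of that of \<open>y\<^sup>M\<close>.  So \<open>O\<^sub>f\<close> is the Taylor expansion \<open>f(x + y)\<close>
  (\<open>flat_lift_pullback\<close>), and \<open>\<star>\<close> is the Moyal-Weyl product with constant coefficients
  (\<open>star_pullback\<close>).

  A function is quantizable once the derivatives of its coefficient of \<open>\<hbar>\<^sup>k\<close> vanish from the order
  \<open>w - 2k\<close> on, for a fixed \<open>w\<close>.  Coordinates have this property, and products inherit it as each \<open>\<hbar>\<close> in
  the Moyal-Weyl product comes with two derivatives (\<open>derivs_vanish_from_moyal_weyl\<close>).  So quantum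
  polynomials are quantizable.

  Conversely there are enough quantum polynomials.  The commutator of two conjugate coordinates
  is \<open>\<hbar>\<close>, and \<open>x\<^sup>i g = x\<^sup>i \<star> g - \<hbar>/2 \<omega>\<^sup>i\<^sup>b \<partial>\<^sub>b g\<close>; hence every polynomial in the coordinates, and its product
  with every power of \<open>\<hbar>\<close>, is a quantum polynomial (\<open>qpoly_polynomial\<close>, \<open>qpoly_at_order\<close>).

  Up to a small tail the metric \<open>d\<^sub>K\<close> involves finitely many coefficients and finitely many of their
  derivatives.  Density thus reduces to a classical fact: on a compact subset of an open set, a
  smooth function and its derivatives up to a given order are uniformly approximated by those of
  a polynomial (\<open>polynomial_approx_derivatives\<close>).  To see this, cut the function off so that it is
  supported in a box, approximate a mixed derivative of high order in every direction by the
  Stone-Weierstrass theorem, and integrate back from the faces of the box; an antiderivative of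
  a polynomial is a polynomial.
\<close>

section \<open>Partial derivatives and smooth functions on open subsets of Euclidean space\<close>

definition pd :: "'m::finite \<Rightarrow> (real ^ 'm \<Rightarrow> 'v::real_normed_vector) \<Rightarrow> real ^ 'm \<Rightarrow> 'v" where
  "pd i G x = frechet_derivative G (at x) (axis i 1)"

definition pds :: "'m::finite list \<Rightarrow> (real ^ 'm \<Rightarrow> 'v::real_normed_vector) \<Rightarrow> real ^ 'm \<Rightarrow> 'v" where
  "pds is G = foldr pd is G"

lemma pds_Nil [simp]: "pds [] G = G"
  and pds_Cons [simp]: "pds (i # is) G = pd i (pds is G)"
  and pds_append: "pds (is @ js) G = pds is (pds js G)"
  by (simp_all add: pds_def)

lemma pds_snoc: "pds (is @ [i]) G = pds is (pd i G)"
  by (simp add: pds_append)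

text \<open>
  The order of differentiability is counted by recursion, with the derivative taken first: closure
  properties of the smooth functions then follow by induction on the order from the rules of
  differentiation, each of which expresses a derivative by functions of the same kind.
\<close>

primrec smooth_order :: "nat \<Rightarrow> (real ^ 'm::finite) set \<Rightarrow> (real ^ 'm \<Rightarrow> 'v::real_normed_vector) \<Rightarrow> bool" where
  "smooth_order 0 V G \<longleftrightarrow> True"
| "smooth_order (Suc n) V G \<longleftrightarrow> (\<forall>x\<in>V. G differentiable at x) \<and> (\<forall>i. smooth_order n V (pd i G))"

definition smooth_on :: "(real ^ 'm::finite) set \<Rightarrow> (real ^ 'm \<Rightarrow> 'v::real_normed_vector) \<Rightarrow> bool" where
  "smooth_on V G \<longleftrightarrow> (\<forall>n. smooth_order n V G)"

lemma pd_eq: "(G has_derivative D) (at x) \<Longrightarrow> pd i G x = D (axis i 1)"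
  by (metis pd_def frechet_derivative_at)

lemma differentiable_cong_open:
  assumes "open V" "x \<in> V" "\<And>y. y \<in> V \<Longrightarrow> F y = G y"
  shows "(F has_derivative D) (at x) \<longleftrightarrow> (G has_derivative D) (at x)"
  using assms by (metis has_derivative_transform_within_open)

lemma pd_cong:
  assumes "open V" "x \<in> V" "\<And>y. y \<in> V \<Longrightarrow> F y = G y"
  shows "pd i F x = pd i G x"
proof -
  have "(F has_derivative D) (at x) \<longleftrightarrow> (G has_derivative D) (at x)" for D
    by (rule differentiable_cong_open[OF assms])
  then show ?thesis by (simp add: pd_def frechet_derivative_def)
qed

lemma pds_cong:
  assumes "open V" "x \<in> V" "\<And>y. y \<in> V \<Longrightarrow> F y = G y"
  shows "pds is F x = pds is G x"
  using assms(2)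
proof (induction "is" arbitrary: x)
  case (Cons i "is")
  then show ?case using pd_cong[OF assms(1), of x "pds is F" "pds is G"] by simp
qed (use assms in simp)

lemma smooth_order_cong:
  assumes "open V" "\<And>y. y \<in> V \<Longrightarrow> F y = G y" "smooth_order n V F"
  shows "smooth_order n V G"
  using assms(2,3)
proof (induction n arbitrary: F G)
  case (Suc n)
  have "G differentiable at x" if "x \<in> V" for x
  proof -
    obtain D where "(F has_derivative D) (at x)"
      using Suc.prems(2) \<open>x \<in> V\<close> by (auto simp: differentiable_def)
    with differentiable_cong_open[of V x F G] assms(1) \<open>x \<in> V\<close> Suc.prems(1) show ?thesis
      unfolding differentiable_def by blast
  qed
  moreover have "smooth_order n V (pd i G)" for i
    using Suc.IH[of "pd i F" "pd i G"] Suc.prems pd_cong[OF assms(1), of _ F G] by auto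
  ultimately show ?case by simp
qed simp

lemma smooth_order_Suc_imp: "smooth_order (Suc n) V G \<Longrightarrow> smooth_order n V G"
  by (induction n arbitrary: G) auto

lemma smooth_on_cong:
  "open V \<Longrightarrow> (\<And>y. y \<in> V \<Longrightarrow> F y = G y) \<Longrightarrow> smooth_on V F \<Longrightarrow> smooth_on V G"
  unfolding smooth_on_def using smooth_order_cong by blast

lemma smooth_on_pd: "smooth_on V G \<Longrightarrow> smooth_on V (pd i G)"
  unfolding smooth_on_def by (metis smooth_order.simps(2))

lemma smooth_on_differentiable: "smooth_on V G \<Longrightarrow> x \<in> V \<Longrightarrow> G differentiable at x"
  unfolding smooth_on_def by (metis smooth_order.simps(2))

lemma smooth_on_pds: "smooth_on V G \<Longrightarrow> smooth_on V (pds is G)"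
  by (induction "is") (auto intro: smooth_on_pd)

lemma smooth_on_iff_pds: "smooth_on V G \<longleftrightarrow> (\<forall>is. \<forall>x\<in>V. pds is G differentiable at x)"
proof
  assume *: "\<forall>is. \<forall>x\<in>V. pds is G differentiable at x"
  have "smooth_order n V (pds js G)" for n js
  proof (induction n arbitrary: js)
    case (Suc n)
    then show ?case using * Suc[of "_ # js"] by simp
  qed simp
  from this[of _ "[]"] show "smooth_on V G" by (simp add: smooth_on_def)
qed (metis smooth_on_pds smooth_on_differentiable)

lemma smooth_on_subset: "smooth_on V G \<Longrightarrow> W \<subseteq> V \<Longrightarrow> smooth_on W G"
  unfolding smooth_on_iff_pds by blast

lemma smooth_on_Un: "smooth_on V G \<Longrightarrow> smooth_on W G \<Longrightarrow> smooth_on (V \<union> W) G"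
  unfolding smooth_on_iff_pds by blast

lemma smooth_on_continuous: "smooth_on V G \<Longrightarrow> continuous_on V G"
  by (metis continuous_at_imp_continuous_on differentiable_imp_continuous_within smooth_on_differentiable)

lemma smooth_on_has_derivative:
  "smooth_on V G \<Longrightarrow> x \<in> V \<Longrightarrow> (G has_derivative frechet_derivative G (at x)) (at x)"
  using smooth_on_differentiable frechet_derivative_works by blast


subsection \<open>Closure properties\<close>

lemma pd_const [simp]: "pd i (\<lambda>x. c) = (\<lambda>x. 0)"
  by (simp add: pd_def fun_eq_iff)

lemma pds_zero [simp]: "pds is (\<lambda>x. 0) = (\<lambda>x. 0)"
  by (induction "is") auto

lemma smooth_on_const [simp]: "smooth_on V (\<lambda>x. c)"
proof -
  have "smooth_order n V (\<lambda>x. c)" for n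
    by (induction n arbitrary: c) auto
  then show ?thesis by (simp add: smooth_on_def)
qed

lemma pd_linear: "bounded_linear f \<Longrightarrow> pd i f = (\<lambda>x. f (axis i 1))"
  by (rule ext) (rule pd_eq, rule bounded_linear_imp_has_derivative)

lemma smooth_on_linear: "bounded_linear f \<Longrightarrow> smooth_on V f"
  unfolding smooth_on_iff_pds
proof (intro allI ballI)
  fix "is" :: "'a list" and x assume f: "bounded_linear f" "x \<in> V"
  show "pds is f differentiable at x"
  proof (cases "is" rule: rev_cases)
    case (snoc js i)
    then show ?thesis
      using smooth_on_differentiable[OF smooth_on_pds[OF smooth_on_const] UNIV_I] f(1)
      by (simp add: pds_snoc pd_linear)
  qed (use f in \<open>simp add: bounded_linear_imp_differentiable\<close>)
qed

lemma differentiable_bilinear: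
  assumes "bounded_bilinear bop" "F differentiable at x" "G differentiable at x"
  shows "(\<lambda>x. bop (F x) (G x)) differentiable at x"
    and "pd i (\<lambda>x. bop (F x) (G x)) x = bop (F x) (pd i G x) + bop (pd i F x) (G x)"
proof -
  have *: "((\<lambda>x. bop (F x) (G x)) has_derivative
      (\<lambda>h. bop (F x) (frechet_derivative G (at x) h) + bop (frechet_derivative F (at x) h) (G x))) (at x)"
    by (rule bounded_bilinear.FDERIV[OF assms(1)]) (use assms frechet_derivative_works in blast)+
  then show "(\<lambda>x. bop (F x) (G x)) differentiable at x" unfolding differentiable_def by blast
  show "pd i (\<lambda>x. bop (F x) (G x)) x = bop (F x) (pd i G x) + bop (pd i F x) (G x)"
    using pd_eq[OF *] by (simp add: pd_def)
qed

lemma differentiable_linear_image: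
  assumes "bounded_linear f" "F differentiable at x"
  shows "(\<lambda>x. f (F x)) differentiable at x" and "pd i (\<lambda>x. f (F x)) x = f (pd i F x)"
proof -
  have *: "((\<lambda>x. f (F x)) has_derivative (\<lambda>h. f (frechet_derivative F (at x) h))) (at x)"
    by (rule bounded_linear.has_derivative[OF assms(1)]) (use assms frechet_derivative_works in blast)
  then show "(\<lambda>x. f (F x)) differentiable at x" unfolding differentiable_def by blast
  show "pd i (\<lambda>x. f (F x)) x = f (pd i F x)"
    using pd_eq[OF *] by (simp add: pd_def)
qed

lemma pd_add:
  assumes "F differentiable at x" "G differentiable at x"
  shows "pd i (\<lambda>x. F x + G x) x = pd i F x + pd i G x"
  using pd_eq[OF has_derivative_add[OF assms[unfolded frechet_derivative_works]]]
  by (simp add: pd_def)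

lemma smooth_order_add:
  assumes V: "open V" and "smooth_order n V F" "smooth_order n V G"
  shows "smooth_order n V (\<lambda>x. F x + G x)"
  using assms(2,3)
proof (induction n arbitrary: F G)
  case (Suc n)
  have "smooth_order n V (pd i (\<lambda>x. F x + G x))" for i
    by (rule smooth_order_cong[OF V, of "\<lambda>x. pd i F x + pd i G x"])
      (use Suc in \<open>auto simp: pd_add\<close>)
  with Suc show ?case by (auto intro: differentiable_add)
qed simp

lemma smooth_order_bilinear:
  assumes V: "open V" and B: "bounded_bilinear bop" and "smooth_order n V F" "smooth_order n V G"
  shows "smooth_order n V (\<lambda>x. bop (F x) (G x))"
  using assms(3,4)
proof (induction n arbitrary: F G)
  case (Suc n)
  have "smooth_order n V (pd i (\<lambda>x. bop (F x) (G x)))" for i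
  proof (rule smooth_order_cong[OF V, of "\<lambda>x. bop (F x) (pd i G x) + bop (pd i F x) (G x)"])
    show "smooth_order n V (\<lambda>x. bop (F x) (pd i G x) + bop (pd i F x) (G x))"
      using Suc.prems Suc.prems[THEN smooth_order_Suc_imp]
      by (intro smooth_order_add[OF V] Suc.IH) simp_all
  qed (use Suc.prems in \<open>simp add: differentiable_bilinear[OF B]\<close>)
  with Suc.prems show ?case by (simp add: differentiable_bilinear(1)[OF B])
qed simp

lemma smooth_on_add: "open V \<Longrightarrow> smooth_on V F \<Longrightarrow> smooth_on V G \<Longrightarrow> smooth_on V (\<lambda>x. F x + G x)"
  by (simp add: smooth_on_def smooth_order_add)

lemma smooth_on_bilinear:
  "open V \<Longrightarrow> bounded_bilinear bop \<Longrightarrow> smooth_on V F \<Longrightarrow> smooth_on V G \<Longrightarrow>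
    smooth_on V (\<lambda>x. bop (F x) (G x))"
  by (simp add: smooth_on_def smooth_order_bilinear)

lemmas smooth_on_scaleR = smooth_on_bilinear[OF _ bounded_bilinear_scaleR]
  and smooth_on_mult = smooth_on_bilinear[OF _ bounded_bilinear_mult]
  and smooth_on_inner = smooth_on_bilinear[OF _ bounded_bilinear_inner]

lemma smooth_on_minus:
  "open V \<Longrightarrow> smooth_on V F \<Longrightarrow> smooth_on V (\<lambda>x. - F x)"
  using smooth_on_scaleR[of V "\<lambda>x. -1" F] by simp

lemma smooth_on_diff:
  "open V \<Longrightarrow> smooth_on V F \<Longrightarrow> smooth_on V G \<Longrightarrow> smooth_on V (\<lambda>x. F x - G x)"
  using smooth_on_add[of V F "\<lambda>x. - G x"] smooth_on_minus[of V G] by simp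

lemma smooth_on_sum:
  "open V \<Longrightarrow> (\<And>a. a \<in> A \<Longrightarrow> smooth_on V (F a)) \<Longrightarrow> smooth_on V (\<lambda>x. \<Sum>a\<in>A. F a x)"
  by (induction A rule: infinite_finite_induct) (auto intro: smooth_on_add)

lemma pds_add:
  assumes "open V" "smooth_on V F" "smooth_on V G" "x \<in> V"
  shows "pds is (\<lambda>x. F x + G x) x = pds is F x + pds is G x"
  using assms(4)
proof (induction "is" arbitrary: x)
  case (Cons i "is")
  have "pd i (pds is (\<lambda>x. F x + G x)) x = pd i (\<lambda>x. pds is F x + pds is G x) x"
    by (rule pd_cong[OF assms(1)]) (use Cons in auto)
  also have "\<dots> = pd i (pds is F) x + pd i (pds is G) x"
    by (rule pd_add[OF smooth_on_differentiable[OF smooth_on_pds[OF assms(2)] Cons.prems]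
          smooth_on_differentiable[OF smooth_on_pds[OF assms(3)] Cons.prems]])
  finally show ?case by simp
qed simp

lemma pds_linear_image:
  assumes "open V" "bounded_linear f" "smooth_on V F" "x \<in> V"
  shows "pds is (\<lambda>x. f (F x)) x = f (pds is F x)"
  using assms(4)
proof (induction "is" arbitrary: x)
  case (Cons i "is")
  have "pd i (pds is (\<lambda>x. f (F x))) x = pd i (\<lambda>x. f (pds is F x)) x"
    by (rule pd_cong[OF assms(1)]) (use Cons in auto)
  also have "\<dots> = f (pd i (pds is F) x)"
    by (rule differentiable_linear_image(2)[OF assms(2)
          smooth_on_differentiable[OF smooth_on_pds[OF assms(3)] Cons.prems]])
  finally show ?case by simp
qed simp

lemma pds_diff:
  assumes "open V" "smooth_on V F" "smooth_on V G" "x \<in> V"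
  shows "pds is (\<lambda>x. F x - G x) x = pds is F x - pds is G x"
  using pds_add[OF assms(1,2) smooth_on_minus[OF assms(1,3)] assms(4)]
    pds_linear_image[OF assms(1) bounded_linear_minus[OF bounded_linear_ident] assms(3,4)]
  by simp

lemma pds_sum:
  assumes "open V" "\<And>a. a \<in> A \<Longrightarrow> smooth_on V (F a)" "x \<in> V"
  shows "pds is (\<lambda>x. \<Sum>a\<in>A. F a x) x = (\<Sum>a\<in>A. pds is (F a) x)"
  using assms(2)
  by (induction A rule: infinite_finite_induct)
    (simp_all add: pds_add[OF assms(1)] smooth_on_sum[OF assms(1)] assms(3))

lemma smooth_on_inverse:
  fixes F :: "real ^ 'm::finite \<Rightarrow> real"
  assumes V: "open V" and F: "smooth_on V F" and nz: "\<And>x. x \<in> V \<Longrightarrow> F x \<noteq> 0"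
  shows "smooth_on V (\<lambda>x. inverse (F x))"
proof -
  have d: "((\<lambda>x. inverse (F x)) has_derivative
      (\<lambda>h. - (inverse (F x) * frechet_derivative F (at x) h * inverse (F x)))) (at x)" if "x \<in> V" for x
    using Deriv.has_derivative_inverse[OF nz[OF that] smooth_on_has_derivative[OF F that]] .
  have "smooth_order n V (\<lambda>x. inverse (F x))" for n
  proof (induction n)
    case (Suc n)
    have "smooth_order n V (pd i (\<lambda>x. inverse (F x)))" for i
    proof (rule smooth_order_cong[OF V, of "\<lambda>x. (- pd i F x) * (inverse (F x) * inverse (F x))"])
      have "smooth_order n V (\<lambda>x. - pd i F x)"
        using smooth_on_minus[OF V smooth_on_pd[OF F]] by (simp add: smooth_on_def)
      with Suc show "smooth_order n V (\<lambda>x. (- pd i F x) * (inverse (F x) * inverse (F x)))"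
        by (intro smooth_order_bilinear[OF V bounded_bilinear_mult])
      show "(- pd i F x) * (inverse (F x) * inverse (F x)) = pd i (\<lambda>x. inverse (F x)) x" if "x \<in> V" for x
        unfolding pd_eq[OF d[OF that]] by (simp add: pd_def)
    qed
    with d show ?case by (auto simp: differentiable_def)
  qed simp
  then show ?thesis by (simp add: smooth_on_def)
qed

text \<open>
  The induction on the order needs the derivative of \<open>h\<close> to be of the same kind as \<open>h\<close>, hence the
  family \<open>H\<close>.
\<close>

lemma smooth_on_compose:
  assumes V: "open V" and F: "smooth_on V F" and h: "h \<in> H"
    and der: "\<And>h. h \<in> H \<Longrightarrow> \<exists>h'\<in>H. \<forall>t. (h has_real_derivative h' t) (at t)"
  shows "smooth_on V (\<lambda>x. h (F x))"
proof -
  have "smooth_order n V (\<lambda>x. h (F x))" for n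
    using h
  proof (induction n arbitrary: h)
    case (Suc n)
    then obtain h' where h': "h' \<in> H" "\<And>t. (h has_real_derivative h' t) (at t)"
      using der by blast
    have d: "((\<lambda>x. h (F x)) has_derivative (\<lambda>y. h' (F x) * frechet_derivative F (at x) y)) (at x)"
      if "x \<in> V" for x
      using has_derivative_compose[OF smooth_on_has_derivative[OF F that] h'(2)[unfolded has_field_derivative_def]]
      by simp
    have "smooth_order n V (pd i (\<lambda>x. h (F x)))" for i
    proof (rule smooth_order_cong[OF V, of "\<lambda>x. h' (F x) * pd i F x"])
      show "smooth_order n V (\<lambda>x. h' (F x) * pd i F x)"
        using Suc.IH[OF h'(1)] smooth_on_pd[OF F]
        by (intro smooth_order_bilinear[OF V bounded_bilinear_mult]) (simp_all add: smooth_on_def)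
      show "h' (F x) * pd i F x = pd i (\<lambda>x. h (F x)) x" if "x \<in> V" for x
        unfolding pd_eq[OF d[OF that]] by (simp add: pd_def)
    qed
    with d show ?case by (auto simp: differentiable_def)
  qed simp
  then show ?thesis by (simp add: smooth_on_def)
qed


subsection \<open>Symmetry of higher derivatives\<close>

lemma pd_has_vector_derivative:
  assumes "G differentiable at (x + t *\<^sub>R axis i 1)"
  shows "((\<lambda>t. G (x + t *\<^sub>R axis i 1)) has_vector_derivative pd i G (x + t *\<^sub>R axis i 1)) (at t)"
proof -
  have "((\<lambda>t. x + t *\<^sub>R axis i (1::real)) has_derivative (\<lambda>s. s *\<^sub>R axis i 1)) (at t)"
    by (auto intro!: derivative_eq_intros)
  from has_derivative_compose[OF this assms[unfolded frechet_derivative_works]]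
  show ?thesis
    unfolding has_vector_derivative_def pd_def
    by (simp add: linear_cmul[OF linear_frechet_derivative[OF assms]])
qed

text \<open>
  The second difference quotient in the directions \<open>i\<close> and \<open>j\<close> is, by two applications of the mean
  value theorem, a value of the mixed derivative nearby; it does not depend on the order of \<open>i\<close>
  and \<open>j\<close>.
\<close>

lemma second_difference_mean_value:
  fixes g :: "real ^ 'm::finite \<Rightarrow> real"
  assumes g: "smooth_on (ball x r) g" and s: "0 < s" "2 * s < r"
  shows "\<exists>z\<in>cball x (2 * s).
    g (x + s *\<^sub>R axis i 1 + s *\<^sub>R axis j 1) - g (x + s *\<^sub>R axis i 1) - g (x + s *\<^sub>R axis j 1) + g x
      = s * s * pd j (pd i g) z"
proof -
  have in_ball: "dist x (x + a *\<^sub>R axis i 1 + b *\<^sub>R axis j 1) \<le> 2 * s" if "\<bar>a\<bar> \<le> s" "\<bar>b\<bar> \<le> s" for a b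
    using that norm_triangle_ineq[of "a *\<^sub>R axis i (1::real)" "b *\<^sub>R axis j (1::real)"]
    by (simp add: dist_norm norm_minus_commute algebra_simps)
  have dif: "g differentiable at (x + a *\<^sub>R axis i 1 + b *\<^sub>R axis j 1)"
    "pd i g differentiable at (x + a *\<^sub>R axis i 1 + b *\<^sub>R axis j 1)" if "\<bar>a\<bar> \<le> s" "\<bar>b\<bar> \<le> s" for a b
    using in_ball[OF that] s g
    by (auto intro!: smooth_on_differentiable[of "ball x r"] smooth_on_pd)
  define \<phi> where "\<phi> t = g (x + s *\<^sub>R axis j 1 + t *\<^sub>R axis i 1) - g (x + t *\<^sub>R axis i 1)" for t
  have "\<exists>\<xi>. 0 < \<xi> \<and> \<xi> < s \<and> \<phi> s - \<phi> 0 =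
    (s - 0) * (pd i g (x + s *\<^sub>R axis j 1 + \<xi> *\<^sub>R axis i 1) - pd i g (x + \<xi> *\<^sub>R axis i 1))"
  proof (rule MVT2[OF s(1)])
    fix t assume t: "0 \<le> t" "t \<le> s"
    have "g differentiable at (x + s *\<^sub>R axis j 1 + t *\<^sub>R axis i 1)"
      using dif(1)[of t s] t s by (simp add: algebra_simps)
    moreover have "g differentiable at (x + t *\<^sub>R axis i 1)" using dif(1)[of t 0] t s by simp
    ultimately show "(\<phi> has_real_derivative
       pd i g (x + s *\<^sub>R axis j 1 + t *\<^sub>R axis i 1) - pd i g (x + t *\<^sub>R axis i 1)) (at t)"
      unfolding \<phi>_def has_real_derivative_iff_has_vector_derivative
      by (intro has_vector_derivative_diff pd_has_vector_derivative)
  qed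
  then obtain \<xi> where \<xi>: "0 < \<xi>" "\<xi> < s" "\<phi> s - \<phi> 0 =
    s * (pd i g (x + s *\<^sub>R axis j 1 + \<xi> *\<^sub>R axis i 1) - pd i g (x + \<xi> *\<^sub>R axis i 1))"
    by auto
  have "\<exists>\<eta>. 0 < \<eta> \<and> \<eta> < s \<and>
    pd i g (x + \<xi> *\<^sub>R axis i 1 + s *\<^sub>R axis j 1) - pd i g (x + \<xi> *\<^sub>R axis i 1 + 0 *\<^sub>R axis j 1)
     = (s - 0) * pd j (pd i g) (x + \<xi> *\<^sub>R axis i 1 + \<eta> *\<^sub>R axis j 1)"
    by (rule MVT2[OF s(1)], unfold has_real_derivative_iff_has_vector_derivative)
      (intro pd_has_vector_derivative dif(2), use \<xi> in auto)
  then obtain \<eta> where \<eta>: "0 < \<eta>" "\<eta> < s"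
    "pd i g (x + \<xi> *\<^sub>R axis i 1 + s *\<^sub>R axis j 1) - pd i g (x + \<xi> *\<^sub>R axis i 1)
     = s * pd j (pd i g) (x + \<xi> *\<^sub>R axis i 1 + \<eta> *\<^sub>R axis j 1)"
    by auto
  have "\<phi> s - \<phi> 0 = s * s * pd j (pd i g) (x + \<xi> *\<^sub>R axis i 1 + \<eta> *\<^sub>R axis j 1)"
    using \<xi>(3) \<eta>(3) by (simp add: algebra_simps)
  moreover have "x + \<xi> *\<^sub>R axis i 1 + \<eta> *\<^sub>R axis j 1 \<in> cball x (2 * s)"
    using in_ball[of \<xi> \<eta>] \<xi> \<eta> by simp
  ultimately show ?thesis
    by (intro bexI[of _ "x + \<xi> *\<^sub>R axis i 1 + \<eta> *\<^sub>R axis j 1"]) (auto simp: \<phi>_def algebra_simps)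
qed

lemma pd_commute_real:
  fixes g :: "real ^ 'm::finite \<Rightarrow> real"
  assumes "open V" "smooth_on V g" "x \<in> V"
  shows "pd i (pd j g) x = pd j (pd i g) x"
proof (rule ccontr)
  assume ne: "pd i (pd j g) x \<noteq> pd j (pd i g) x"
  define e where "e = \<bar>pd i (pd j g) x - pd j (pd i g) x\<bar> / 2"
  have e: "e > 0" using ne by (simp add: e_def)
  have "isCont (pd i (pd j g)) x" "isCont (pd j (pd i g)) x"
    using assms by (auto intro!: differentiable_imp_continuous_within smooth_on_differentiable[of V] smooth_on_pd)
  then obtain r1 r2 where r12: "r1 > 0" "r2 > 0"
    "\<And>y. dist y x < r1 \<Longrightarrow> dist (pd i (pd j g) y) (pd i (pd j g) x) < e"
    "\<And>y. dist y x < r2 \<Longrightarrow> dist (pd j (pd i g) y) (pd j (pd i g) x) < e"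
    using e unfolding continuous_at_eps_delta by metis
  obtain r3 where r3: "r3 > 0" "ball x r3 \<subseteq> V"
    using assms openE by blast
  define r where "r = min r1 (min r2 r3)"
  have r: "r > 0" "smooth_on (ball x r) g"
    using r12 r3 by (auto simp: r_def intro!: smooth_on_subset[OF assms(2)])
  define s where "s = r / 4"
  have s: "0 < s" "2 * s < r" using r by (auto simp: s_def)
  obtain z where z: "z \<in> cball x (2 * s)"
    "g (x + s *\<^sub>R axis i 1 + s *\<^sub>R axis j 1) - g (x + s *\<^sub>R axis i 1) - g (x + s *\<^sub>R axis j 1) + g x
      = s * s * pd j (pd i g) z"
    using second_difference_mean_value[OF r(2) s] by blast
  obtain w where w: "w \<in> cball x (2 * s)"
    "g (x + s *\<^sub>R axis j 1 + s *\<^sub>R axis i 1) - g (x + s *\<^sub>R axis j 1) - g (x + s *\<^sub>R axis i 1) + g x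
      = s * s * pd i (pd j g) w"
    using second_difference_mean_value[OF r(2) s] by blast
  have "s * s * pd j (pd i g) z = s * s * pd i (pd j g) w"
    using z(2) w(2) by (simp add: algebra_simps)
  then have "pd j (pd i g) z = pd i (pd j g) w" using s by simp
  moreover have "dist (pd i (pd j g) w) (pd i (pd j g) x) < e" "dist (pd j (pd i g) z) (pd j (pd i g) x) < e"
    using z(1) w(1) s r12(3)[of w] r12(4)[of z] by (auto simp: r_def dist_commute)
  ultimately show False
    unfolding e_def dist_real_def by (simp add: abs_if split: if_splits)
qed

lemma pd_commute:
  fixes G :: "real ^ 'm::finite \<Rightarrow> 'v::euclidean_space"
  assumes "open V" "smooth_on V G" "x \<in> V"
  shows "pd i (pd j G) x = pd j (pd i G) x"
proof (rule euclidean_eqI)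
  fix b :: 'v assume "b \<in> Basis"
  have sm: "smooth_on V (\<lambda>x. G x \<bullet> b)"
    by (intro smooth_on_inner assms smooth_on_const)
  have "pds is (\<lambda>x. G x \<bullet> b) x = pds is G x \<bullet> b" for "is"
    by (rule pds_linear_image[OF assms(1) bounded_linear_inner_left assms(2,3)])
  from this[of "[i, j]"] this[of "[j, i]"] show "pd i (pd j G) x \<bullet> b = pd j (pd i G) x \<bullet> b"
    using pd_commute_real[OF assms(1) sm assms(3), of i j] by simp
qed

lemma pds_pd_commute:
  fixes G :: "real ^ 'm::finite \<Rightarrow> 'v::euclidean_space"
  assumes V: "open V" and "smooth_on V G" "x \<in> V"
  shows "pds is (pd i G) x = pd i (pds is G) x"
  using assms(3)
proof (induction "is" arbitrary: x)
  case (Cons j "is")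
  have "pd j (pds is (pd i G)) x = pd j (pd i (pds is G)) x"
    by (rule pd_cong[OF V]) (use Cons in auto)
  also have "\<dots> = pd i (pd j (pds is G)) x"
    by (rule pd_commute[OF V]) (use assms Cons in \<open>auto intro: smooth_on_pds\<close>)
  finally show ?case by simp
qed simp

lemma pds_permute:
  fixes G :: "real ^ 'm::finite \<Rightarrow> 'v::euclidean_space"
  assumes V: "open V" and "smooth_on V G" "x \<in> V" "mset is = mset js"
  shows "pds is G x = pds js G x"
  using assms(3,4)
proof (induction "is" arbitrary: js x)
  case (Cons i "is")
  then have "i \<in> set js" by (metis list.set_intros(1) set_mset_mset)
  then obtain js1 js2 where js: "js = js1 @ i # js2" by (meson split_list)
  have "pd i (pds is G) x = pd i (pds (js1 @ js2) G) x"
    by (rule pd_cong[OF V]) (use Cons js in auto)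
  also have "\<dots> = pds js1 (pd i (pds js2 G)) x"
    unfolding pds_append by (rule pds_pd_commute[OF V, symmetric]) (use assms Cons in \<open>auto intro: smooth_on_pds\<close>)
  finally show ?case by (simp add: js pds_append)
qed simp


section \<open>Smooth cut-off functions\<close>

text \<open>
  The function \<open>exp (-1/t)\<close>, continued by zero to \<open>t \<le> 0\<close>, with a polynomial factor in \<open>1/t\<close>: with
  this factor the family is closed under derivation.
\<close>

definition poly_exp_inv :: "real poly \<Rightarrow> real \<Rightarrow> real" where
  "poly_exp_inv P t = (if t > 0 then poly P (inverse t) * exp (- inverse t) else 0)"

lemma poly_times_exp_tendsto_0: "((\<lambda>u. poly P u * exp (- u)) \<longlongrightarrow> 0) at_top" for P :: "real poly"
proof -
  have "((\<lambda>u. \<Sum>i\<le>degree P. coeff P i * (u ^ i / exp u)) \<longlongrightarrow> (\<Sum>i\<le>degree P. coeff P i * 0)) at_top"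
    by (intro tendsto_sum tendsto_mult tendsto_const tendsto_power_div_exp_0)
  moreover have "(\<Sum>i\<le>degree P. coeff P i * (u ^ i / exp u)) = poly P u * exp (- u)" for u
    by (simp add: poly_altdef exp_minus sum_distrib_right divide_inverse mult.assoc)
  ultimately show ?thesis by simp
qed

lemma poly_exp_inv_has_derivative:
  "(poly_exp_inv P has_real_derivative poly_exp_inv ([:0, 0, 1:] * (P - pderiv P)) t) (at t)"
proof (cases t "0 :: real" rule: linorder_cases)
  case less
  have "((\<lambda>_. 0) has_real_derivative 0) (at t)" by simp
  moreover have "poly_exp_inv ([:0, 0, 1:] * (P - pderiv P)) t = 0" using less by (simp add: poly_exp_inv_def)
  ultimately show ?thesis
    using has_field_derivative_transform_within_open[of "\<lambda>_. 0" 0 t "{..<0}" "poly_exp_inv P"] less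
    by (auto simp: poly_exp_inv_def)
next
  case greater
  have "((\<lambda>t. poly P (inverse t) * exp (- inverse t)) has_real_derivative
      poly_exp_inv ([:0, 0, 1:] * (P - pderiv P)) t) (at t)"
    using greater
    by (auto intro!: derivative_eq_intros simp: poly_exp_inv_def power2_eq_square field_simps)
  then show ?thesis
    by (rule has_field_derivative_transform_within_open[of _ _ _ "{0<..}"])
      (use greater in \<open>auto simp: poly_exp_inv_def\<close>)
next
  case equal
  have "((\<lambda>y. (poly_exp_inv P y - poly_exp_inv P 0) / (y - 0)) \<longlongrightarrow> 0) (at 0)"
    unfolding filterlim_at_split
  proof
    have "eventually (\<lambda>y. (poly_exp_inv P y - poly_exp_inv P 0) / (y - 0) = 0) (at_left 0)"
      by (auto simp: eventually_at_filter poly_exp_inv_def)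
    then show "((\<lambda>y. (poly_exp_inv P y - poly_exp_inv P 0) / (y - 0)) \<longlongrightarrow> 0) (at_left 0)"
      by (rule tendsto_eventually)
    have "((\<lambda>y. poly ([:0, 1:] * P) (inverse y) * exp (- inverse y)) \<longlongrightarrow> 0) (at_right 0)"
      by (rule filterlim_compose[OF poly_times_exp_tendsto_0 filterlim_inverse_at_top_right])
    moreover have "eventually (\<lambda>y. poly ([:0, 1:] * P) (inverse y) * exp (- inverse y)
        = (poly_exp_inv P y - poly_exp_inv P 0) / (y - 0)) (at_right 0)"
      by (auto simp: eventually_at_filter poly_exp_inv_def field_simps)
    ultimately show "((\<lambda>y. (poly_exp_inv P y - poly_exp_inv P 0) / (y - 0)) \<longlongrightarrow> 0) (at_right 0)"
      by (rule Lim_transform_eventually)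
  qed
  then show ?thesis
    unfolding has_field_derivative_iff equal by (simp add: poly_exp_inv_def)
qed

lemma smooth_on_poly_exp_inv:
  "open V \<Longrightarrow> smooth_on V F \<Longrightarrow> smooth_on V (\<lambda>x. poly_exp_inv P (F x))"
  using smooth_on_compose[of V F "poly_exp_inv P" "range poly_exp_inv"] poly_exp_inv_has_derivative by blast

lemma poly_exp_inv_1: "poly_exp_inv 1 t \<ge> 0" "poly_exp_inv 1 t > 0 \<longleftrightarrow> t > 0" "t \<le> 0 \<Longrightarrow> poly_exp_inv 1 t = 0"
  by (auto simp: poly_exp_inv_def)

text \<open>
  A sum \<open>\<psi>\<close> of bumps on balls that cover \<open>K\<close> is positive on \<open>K\<close>; composed with a smooth step it becomes
  constant near \<open>K\<close>.
\<close>

lemma smooth_cutoff: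
  fixes K V :: "(real ^ 'm::finite) set"
  assumes K: "compact K" and V: "open V" "K \<subseteq> V"
  obtains \<eta> :: "real ^ 'm \<Rightarrow> real" and N S where "smooth_on UNIV \<eta>"
    "open N" "K \<subseteq> N" "\<And>x. x \<in> N \<Longrightarrow> \<eta> x = 1"
    "compact S" "S \<subseteq> V" "\<And>x. x \<notin> S \<Longrightarrow> \<eta> x = 0"
proof (cases "K = {}")
  case True
  show ?thesis using that[of "\<lambda>x. 0" "{}" "{}"] True by simp
next
  case False
  have "\<forall>a\<in>K. \<exists>r>0. cball a r \<subseteq> V"
    using V by (meson open_contains_cball subsetD)
  then obtain r where r: "\<And>a. a \<in> K \<Longrightarrow> r a > 0" "\<And>a. a \<in> K \<Longrightarrow> cball a (r a) \<subseteq> V"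
    by metis
  have "K \<subseteq> (\<Union>a\<in>K. ball a (r a))" using r by force
  then obtain A where A: "A \<subseteq> K" "finite A" "K \<subseteq> (\<Union>a\<in>A. ball a (r a))"
    using compactE_image[OF K, of K "\<lambda>a. ball a (r a)"] by auto
  define \<psi> where "\<psi> x = (\<Sum>a\<in>A. poly_exp_inv 1 ((r a)\<^sup>2 - (x - a) \<bullet> (x - a)))" for x
  have bump_pos: "poly_exp_inv 1 ((r a)\<^sup>2 - (x - a) \<bullet> (x - a)) > 0 \<longleftrightarrow> x \<in> ball a (r a)" if "a \<in> A" for a x
  proof -
    have "(x - a) \<bullet> (x - a) < (r a)\<^sup>2 \<longleftrightarrow> norm (x - a) < r a"
      using r(1)[of a] that A(1) abs_less_iff power2_less_imp_less[of "norm (x - a)" "r a"]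
      by (auto simp: dot_square_norm intro: power_strict_mono)
    then show ?thesis by (simp add: poly_exp_inv_1(2) dist_norm norm_minus_commute)
  qed
  have "smooth_on UNIV (\<lambda>x. (x - a) \<bullet> (x - a))" for a :: "real ^ 'm"
    by (intro smooth_on_inner smooth_on_diff smooth_on_linear bounded_linear_ident smooth_on_const open_UNIV)
  then have sm: "smooth_on UNIV \<psi>"
    unfolding \<psi>_def by (intro smooth_on_sum smooth_on_poly_exp_inv smooth_on_diff smooth_on_const open_UNIV)
  have pos: "\<psi> x > 0" if x: "x \<in> K" for x
  proof -
    obtain a where "a \<in> A" "x \<in> ball a (r a)" using x A(3) by blast
    then show ?thesis unfolding \<psi>_def using bump_pos poly_exp_inv_1(1) A(2) by (intro sum_pos2[of A a]) auto
  qed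
  have cont: "continuous_on UNIV \<psi>" by (rule smooth_on_continuous[OF sm])
  obtain x0 where x0: "x0 \<in> K" "\<And>x. x \<in> K \<Longrightarrow> \<psi> x0 \<le> \<psi> x"
    using continuous_attains_inf[OF K False continuous_on_subset[OF cont]] by auto
  define m where "m = \<psi> x0 / 2"
  have m: "m > 0" "\<And>x. x \<in> K \<Longrightarrow> m < \<psi> x"
    using pos[OF x0(1)] x0(2) by (force simp: m_def)+
  define \<eta> where "\<eta> x = poly_exp_inv 1 (\<psi> x) * inverse (poly_exp_inv 1 (\<psi> x) + poly_exp_inv 1 (m - \<psi> x))" for x
  have den: "poly_exp_inv 1 (\<psi> x) + poly_exp_inv 1 (m - \<psi> x) > 0" for x
    using poly_exp_inv_1(1)[of "\<psi> x"] poly_exp_inv_1(1)[of "m - \<psi> x"] poly_exp_inv_1(2)[of "\<psi> x"] poly_exp_inv_1(2)[of "m - \<psi> x"] m(1)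
    by (cases "\<psi> x > 0") (auto intro: add_pos_nonneg add_nonneg_pos)
  show ?thesis
  proof (rule that[of \<eta> "{x. m < \<psi> x}" "\<Union>a\<in>A. cball a (r a)"])
    show "smooth_on UNIV \<eta>"
      unfolding \<eta>_def using den
      by (intro smooth_on_mult smooth_on_inverse smooth_on_add smooth_on_poly_exp_inv smooth_on_diff sm
          smooth_on_const open_UNIV) (simp add: less_imp_neq[THEN not_sym])
    show "open {x. m < \<psi> x}" using open_Collect_less[OF continuous_on_const cont] .
    show "\<eta> x = 1" if "x \<in> {x. m < \<psi> x}" for x
      using that m(1) den[of x] by (simp add: \<eta>_def poly_exp_inv_1(3))
    show "\<eta> x = 0" if "x \<notin> (\<Union>a\<in>A. cball a (r a))" for x
    proof -
      have "poly_exp_inv 1 ((r a)\<^sup>2 - (x - a) \<bullet> (x - a)) = 0" if "a \<in> A" for a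
      proof -
        have "x \<notin> ball a (r a)" using \<open>x \<notin> _\<close> that ball_subset_cball by blast
        then show ?thesis using bump_pos[OF that, of x] poly_exp_inv_1(1) by (metis less_eq_real_def)
      qed
      then have "\<psi> x = 0" by (simp add: \<psi>_def)
      then show ?thesis by (simp add: \<eta>_def poly_exp_inv_1(3))
    qed
    show "(\<Union>a\<in>A. cball a (r a)) \<subseteq> V" using A(1) r(2) by blast
  qed (use A(2) m in auto)
qed


section \<open>Polynomial approximation of all derivatives up to a given order\<close>

lemma smooth_on_real_polynomial: "real_polynomial_function p \<Longrightarrow> smooth_on UNIV p"
  by (induction rule: real_polynomial_function.induct)
    (auto intro: smooth_on_linear smooth_on_add smooth_on_mult)

lemma smooth_on_polynomial:
  fixes p :: "real ^ 'm::finite \<Rightarrow> 'v::euclidean_space"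
  assumes "polynomial_function p"
  shows "smooth_on UNIV p"
proof -
  have "smooth_on UNIV (\<lambda>x. \<Sum>b\<in>Basis. (p x \<bullet> b) *\<^sub>R b)"
    using assms unfolding polynomial_function_iff_Basis_inner
    by (intro smooth_on_sum smooth_on_scaleR smooth_on_real_polynomial smooth_on_const open_UNIV) auto
  then show ?thesis by (simp add: euclidean_representation)
qed

text \<open>
  The powers of \<open>x\<^sub>i - a\<close> make the property stable under multiplication by a polynomial \<open>q\<close>: a linear \<open>q\<close>
  is a multiple of \<open>x\<^sub>i - a\<close> plus a function that does not depend on \<open>x\<^sub>i\<close>.
\<close>

definition has_antiderivatives :: "'m::finite \<Rightarrow> real \<Rightarrow> (real ^ 'm \<Rightarrow> real) \<Rightarrow> bool" where
  "has_antiderivatives i a h \<longleftrightarrow> (\<forall>k. \<exists>p. real_polynomial_function p \<and>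
     (\<forall>x. pd i p x = (x $ i - a) ^ k * h x) \<and> (\<forall>x. x $ i = a \<longrightarrow> p x = 0))"

lemma has_antiderivatives_1: "has_antiderivatives i a (\<lambda>x. 1)"
  unfolding has_antiderivatives_def
proof (intro allI exI conjI impI)
  fix k
  let ?p = "\<lambda>x :: real ^ 'a. (x $ i - a) ^ Suc k / real (Suc k)"
  show "real_polynomial_function ?p"
    by (intro real_polynomial_function_divide real_polynomial_function_power real_polynomial_function_diff
        real_polynomial_function.intros bounded_linear_vec_nth)
  show "pd i ?p x = (x $ i - a) ^ k * 1" for x
  proof -
    have "(?p has_derivative (\<lambda>y. (real (Suc k) * (y $ i) * (x $ i - a) ^ k) / real (Suc k))) (at x)"
      by (auto intro!: derivative_eq_intros bounded_linear.has_derivative[OF bounded_linear_vec_nth]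
          simp del: of_nat_Suc power_Suc)
    from pd_eq[OF this] show ?thesis by (simp add: axis_def)
  qed
  show "?p x = 0" if "x $ i = a" for x using that by simp
qed

lemma has_antiderivatives_mult:
  assumes "real_polynomial_function q" "has_antiderivatives i a h"
  shows "has_antiderivatives i a (\<lambda>x. q x * h x)"
  using assms
proof (induction arbitrary: h rule: real_polynomial_function.induct)
  case (linear f)
  define L where "L x = f (x - (x $ i) *\<^sub>R axis i 1)" for x
  define g where "g x = L x + a * f (axis i 1)" for x
  have L: "bounded_linear L"
    unfolding L_def using linear(1) 
    by (intro bounded_linear_compose[OF linear(1)] bounded_linear_sub bounded_linear_ident
        bounded_linear_scaleR_const bounded_linear_vec_nth)
  interpret f: bounded_linear f by fact
  have f_eq: "f x = (x $ i - a) * f (axis i 1) + g x" for x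
    by (simp add: g_def L_def f.diff f.scaleR algebra_simps)
  have g: "real_polynomial_function g"
    unfolding g_def by (rule real_polynomial_function.intros(3)) (intro real_polynomial_function.intros L)+
  have pd_g: "pd i g x = 0" for x
    unfolding g_def using pd_add[of L x "\<lambda>_. a * f (axis i 1)" i] L
    by (simp add: pd_linear L_def bounded_linear_imp_differentiable)
  show ?case
    unfolding has_antiderivatives_def
  proof
    fix k
    obtain p0 where p0: "real_polynomial_function p0" "\<And>x. pd i p0 x = (x $ i - a) ^ k * h x"
      "\<And>x. x $ i = a \<Longrightarrow> p0 x = 0"
      using linear(2) unfolding has_antiderivatives_def by metis
    obtain p1 where p1: "real_polynomial_function p1" "\<And>x. pd i p1 x = (x $ i - a) ^ Suc k * h x"
      "\<And>x. x $ i = a \<Longrightarrow> p1 x = 0"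
      using linear(2) unfolding has_antiderivatives_def by metis
    have d: "p0 differentiable at x" "p1 differentiable at x" "g differentiable at x" for x
      using p0 p1 g by (auto intro: smooth_on_differentiable[OF smooth_on_real_polynomial])
    have "pd i (\<lambda>x. f (axis i 1) * p1 x + g x * p0 x) x = (x $ i - a) ^ k * (f x * h x)" for x
    proof -
      have "pd i (\<lambda>x. f (axis i 1) * p1 x + g x * p0 x) x
          = pd i (\<lambda>x. f (axis i 1) * p1 x) x + pd i (\<lambda>x. g x * p0 x) x"
        by (intro pd_add differentiable_bilinear(1)[OF bounded_bilinear_mult] d differentiable_const)
      also have "\<dots> = f (axis i 1) * pd i p1 x + g x * pd i p0 x"
        using differentiable_bilinear(2)[OF bounded_bilinear_mult d(3,1)]
          differentiable_bilinear(2)[OF bounded_bilinear_mult differentiable_const d(2)]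
        by (simp add: pd_g)
      finally show ?thesis by (simp add: p0 p1 f_eq[of x] algebra_simps)
    qed
    then show "\<exists>p. real_polynomial_function p \<and> (\<forall>x. pd i p x = (x $ i - a) ^ k * (f x * h x)) \<and>
        (\<forall>x. x $ i = a \<longrightarrow> p x = 0)"
      using p0 p1 g
      by (intro exI[of _ "\<lambda>x. f (axis i 1) * p1 x + g x * p0 x"] conjI real_polynomial_function.intros(2-4)) auto
  qed
next
  case (const c)
  show ?case
    unfolding has_antiderivatives_def
  proof
    fix k
    obtain p where p: "real_polynomial_function p" "\<And>x. pd i p x = (x $ i - a) ^ k * h x"
      "\<And>x. x $ i = a \<Longrightarrow> p x = 0"
      using const unfolding has_antiderivatives_def by metis
    have "pd i (\<lambda>x. c * p x) x = c * pd i p x" for x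
      by (rule differentiable_linear_image(2)[OF bounded_linear_mult_right
            smooth_on_differentiable[OF smooth_on_real_polynomial[OF p(1)] UNIV_I]])
    then show "\<exists>p. real_polynomial_function p \<and> (\<forall>x. pd i p x = (x $ i - a) ^ k * (c * h x)) \<and>
        (\<forall>x. x $ i = a \<longrightarrow> p x = 0)"
      using p by (intro exI[of _ "\<lambda>x. c * p x"]) auto
  qed
next
  case (add f g)
  show ?case
    unfolding has_antiderivatives_def
  proof
    fix k
    obtain p where p: "real_polynomial_function p" "\<And>x. pd i p x = (x $ i - a) ^ k * (f x * h x)"
      "\<And>x. x $ i = a \<Longrightarrow> p x = 0"
      using add.IH(1)[OF add.prems] unfolding has_antiderivatives_def by metis
    obtain q where q: "real_polynomial_function q" "\<And>x. pd i q x = (x $ i - a) ^ k * (g x * h x)"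
      "\<And>x. x $ i = a \<Longrightarrow> q x = 0"
      using add.IH(2)[OF add.prems] unfolding has_antiderivatives_def by metis
    have "pd i (\<lambda>x. p x + q x) x = pd i p x + pd i q x" for x
      by (rule pd_add[OF smooth_on_differentiable[OF smooth_on_real_polynomial[OF p(1)] UNIV_I]
            smooth_on_differentiable[OF smooth_on_real_polynomial[OF q(1)] UNIV_I]])
    then show "\<exists>p. real_polynomial_function p \<and> (\<forall>x. pd i p x = (x $ i - a) ^ k * ((f x + g x) * h x)) \<and>
        (\<forall>x. x $ i = a \<longrightarrow> p x = 0)"
      using p q by (intro exI[of _ "\<lambda>x. p x + q x"]) (auto simp: algebra_simps)
  qed
next
  case (mult f g)
  show ?case using mult.IH(1)[OF mult.IH(2)[OF mult.prems]] by (simp add: mult.assoc)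
qed

lemma polynomial_antiderivative:
  fixes q :: "real ^ 'm::finite \<Rightarrow> 'v::euclidean_space"
  assumes "polynomial_function q"
  obtains p where "polynomial_function p" "\<And>x. pd i p x = q x" "\<And>x. x $ i = a \<Longrightarrow> p x = 0"
proof -
  have "\<exists>p. real_polynomial_function p \<and> (\<forall>x. pd i p x = q x \<bullet> b) \<and> (\<forall>x. x $ i = a \<longrightarrow> p x = 0)"
    if "b \<in> Basis" for b
  proof -
    have "has_antiderivatives i a (\<lambda>x. (q x \<bullet> b) * 1)"
      using assms that unfolding polynomial_function_iff_Basis_inner
      by (intro has_antiderivatives_mult has_antiderivatives_1) auto
    then obtain p where "real_polynomial_function p" "\<forall>x. pd i p x = (x $ i - a) ^ 0 * ((q x \<bullet> b) * 1)"
      "\<forall>x. x $ i = a \<longrightarrow> p x = 0"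
      unfolding has_antiderivatives_def by blast
    then show ?thesis by auto
  qed
  then obtain P where P: "\<And>b. b \<in> Basis \<Longrightarrow> real_polynomial_function (P b)"
    "\<And>b x. b \<in> Basis \<Longrightarrow> pd i (P b) x = q x \<bullet> b" "\<And>b x. b \<in> Basis \<Longrightarrow> x $ i = a \<Longrightarrow> P b x = 0"
    by metis
  let ?p = "\<lambda>x. \<Sum>b\<in>Basis. P b x *\<^sub>R b"
  have sm: "smooth_on UNIV (P b)" if "b \<in> Basis" for b
    using P(1)[OF that] by (rule smooth_on_real_polynomial)
  have "pd i ?p x = q x" for x
  proof -
    have "pds [i] ?p x = (\<Sum>b\<in>Basis. pds [i] (\<lambda>x. P b x *\<^sub>R b) x)"
      by (rule pds_sum[OF open_UNIV]) (auto intro: smooth_on_scaleR sm)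
    also have "\<dots> = (\<Sum>b\<in>Basis. pds [i] (P b) x *\<^sub>R b)"
      by (intro sum.cong refl pds_linear_image[OF open_UNIV bounded_linear_scaleR_left]) (auto intro: sm)
    finally show ?thesis by (simp add: P(2) euclidean_representation)
  qed
  moreover have "polynomial_function ?p"
    using P(1) unfolding polynomial_function_iff_Basis_inner
    by (auto simp: inner_sum_left inner_Basis intro!: real_polynomial_function_sum)
  ultimately show ?thesis using P(3) by (intro that[of ?p]) auto
qed

text \<open>A derivative in a direction along a hyperplane only sees the values on the hyperplane.\<close>

lemma pds_zero_on_hyperplane:
  assumes "smooth_on UNIV w" "\<And>x. x $ i = a \<Longrightarrow> w x = 0" "i \<notin> set is" "x $ i = a"
  shows "pds is w x = 0"
  using assms(3,4)
proof (induction "is" arbitrary: x)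
  case (Cons j "is")
  have "((\<lambda>t. pds is w (x + t *\<^sub>R axis j 1)) has_vector_derivative pd j (pds is w) (x + 0 *\<^sub>R axis j 1)) (at 0)"
    by (rule pd_has_vector_derivative) (use assms in \<open>auto intro: smooth_on_differentiable smooth_on_pds\<close>)
  moreover have "(\<lambda>t. pds is w (x + t *\<^sub>R axis j 1)) = (\<lambda>t. 0)"
    using Cons by (auto simp: axis_def fun_eq_iff)
  ultimately have "((\<lambda>t::real. 0) has_vector_derivative pd j (pds is w) x) (at 0)" by simp
  from vector_derivative_unique_at[OF this has_vector_derivative_const] show ?case by simp
qed (use assms in auto)

lemma norm_le_of_zero_on_hyperplane:
  fixes v :: "real ^ 'm::finite \<Rightarrow> 'v::euclidean_space"
  assumes v: "\<And>x. v differentiable at x" "\<And>x. x $ i = a \<Longrightarrow> v x = 0"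
    and bound: "\<And>x. x \<in> {x. \<forall>j. a \<le> x $ j \<and> x $ j \<le> b} \<Longrightarrow> norm (pd i v x) \<le> e"
    and x: "x \<in> {x. \<forall>j. a \<le> x $ j \<and> x $ j \<le> b}"
  shows "norm (v x) \<le> e * (b - a)"
proof -
  define T where "T = x $ i - a"
  define y where "y = x - T *\<^sub>R axis i 1"
  have T: "0 \<le> T" "T \<le> b - a" using x by (auto simp: T_def)
  have y: "(y + t *\<^sub>R axis i 1) $ j = (if j = i then a + t else x $ j)" for t j
    by (auto simp: y_def T_def axis_def)
  have der: "((\<lambda>t. v (y + t *\<^sub>R axis i 1)) has_derivative (\<lambda>s. s *\<^sub>R pd i v (y + t *\<^sub>R axis i 1))) (at t)" for t
    using pd_has_vector_derivative[OF v(1)] by (simp add: has_vector_derivative_def)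
  have zero: "v y = 0" using y[of 0 i] by (intro v(2)) simp
  have e: "e \<ge> 0" using bound[OF x] norm_ge_zero order_trans by blast
  show ?thesis
  proof (cases "T = 0")
    case True
    then show ?thesis using zero e T by (simp add: y_def)
  next
    case False
    have "\<exists>t\<in>{0<..<T}. norm (v (y + T *\<^sub>R axis i 1) - v (y + 0 *\<^sub>R axis i 1))
        \<le> norm ((T - 0) *\<^sub>R pd i v (y + t *\<^sub>R axis i 1))"
      by (rule mvt_general[where f = "\<lambda>t. v (y + t *\<^sub>R axis i 1)"])
        (use False T der in \<open>auto intro!: has_derivative_continuous_on[OF has_derivative_at_withinI]\<close>)
    then obtain t where t: "t \<in> {0<..<T}" "norm (v x) \<le> T * norm (pd i v (y + t *\<^sub>R axis i 1))"
      using zero T by (auto simp: y_def)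
    have "y + t *\<^sub>R axis i 1 \<in> {x. \<forall>j. a \<le> x $ j \<and> x $ j \<le> b}"
      using t(1) x T unfolding y mem_Collect_eq by auto
    from bound[OF this] have "T * norm (pd i v (y + t *\<^sub>R axis i 1)) \<le> (b - a) * e"
      using T e by (intro mult_mono) auto
    with t(2) show ?thesis by (simp add: mult.commute)
  qed
qed

text \<open>
  In the box, a smooth function supported above the lower faces is recovered from any of its mixed
  derivatives by repeated integration from these faces.  So an approximation of the derivative along \<open>L\<close>, given by the
  Stone-Weierstrass theorem, becomes one of all derivatives along parts of \<open>L\<close> after the same
  integrations: each one costs a factor at most the length of the box.
\<close>

lemma polynomial_approx_box:
  fixes u :: "real ^ 'm::finite \<Rightarrow> 'v::euclidean_space"
  assumes "smooth_on UNIV u" "closed S" "\<And>x. x \<notin> S \<Longrightarrow> u x = 0"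
    and S: "\<And>x i. x \<in> S \<Longrightarrow> a < x $ i" and ab: "a < b" and "e > 0"
  shows "\<exists>p. polynomial_function p \<and> (\<forall>is. mset is \<subseteq># mset L \<longrightarrow>
    (\<forall>x\<in>{x. \<forall>j. a \<le> x $ j \<and> x $ j \<le> b}. norm (pds is (\<lambda>x. u x - p x) x) \<le> e))"
  using assms(1,3,6)
proof (induction L arbitrary: u e)
  case Nil
  have box: "{x. \<forall>j. a \<le> x $ j \<and> x $ j \<le> b} = cbox (\<chi> j. a) (\<chi> j. b)"
    by (auto simp: mem_box_cart)
  have "continuous_on (cbox (\<chi> j. a) (\<chi> j. b)) u"
    using smooth_on_continuous[OF Nil(1)] continuous_on_subset by blast
  from Stone_Weierstrass_polynomial_function[OF compact_cbox this Nil(3)]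
  obtain p where "polynomial_function p" "\<forall>x\<in>cbox (\<chi> j. a) (\<chi> j. b). norm (u x - p x) < e" by blast
  then show ?case unfolding box by (auto intro: less_imp_le)
next
  case (Cons i L)
  define e' where "e' = e / (1 + (b - a))"
  have e': "e' > 0" "e' \<le> e" "e' * (b - a) \<le> e"
    using Cons(4) ab by (auto simp: e'_def divide_simps algebra_simps)
  have "pd i u x = 0" if "x \<notin> S" for x
    using pd_cong[of "- S" x u "\<lambda>_. 0"] that Cons.prems(2) assms(2) by (simp add: open_Compl)
  from Cons.IH[OF smooth_on_pd[OF Cons.prems(1)] this e'(1)]
  obtain q where q: "polynomial_function q" "\<And>is x. mset is \<subseteq># mset L \<Longrightarrow>
    x \<in> {x. \<forall>j. a \<le> x $ j \<and> x $ j \<le> b} \<Longrightarrow> norm (pds is (\<lambda>x. pd i u x - q x) x) \<le> e'"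
    by blast
  obtain p where p: "polynomial_function p" "\<And>x. pd i p x = q x" "\<And>x. x $ i = a \<Longrightarrow> p x = 0"
    by (rule polynomial_antiderivative[OF q(1), of i a]) blast
  define w where "w x = u x - p x" for x
  have w: "smooth_on UNIV w"
    unfolding w_def by (intro smooth_on_diff Cons.prems smooth_on_polynomial p open_UNIV)
  have w0: "w x = 0" if "x $ i = a" for x
    using that p(3) S[of x i] Cons.prems(2)[of x] by (cases "x \<in> S") (auto simp: w_def)
  have pd_w: "pd i w = (\<lambda>x. pd i u x - q x)"
    unfolding w_def using pds_diff[OF open_UNIV Cons.prems(1) smooth_on_polynomial[OF p(1)], of _ "[i]"]
    by (auto simp: p(2))
  have "norm (pds is w x) \<le> e" if "is": "mset is \<subseteq># mset (i # L)" and x: "x \<in> {x. \<forall>j. a \<le> x $ j \<and> x $ j \<le> b}"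
    for "is" x
  proof (cases "i \<in> set is")
    case True
    then have "mset is = mset (remove1 i is @ [i])" by simp
    then have "pds is w x = pds (remove1 i is @ [i]) w x" by (rule pds_permute[OF open_UNIV w UNIV_I])
    then have "pds is w x = pds (remove1 i is) (\<lambda>x. pd i u x - q x) x" by (simp add: pds_snoc pd_w)
    moreover have "mset (remove1 i is) \<subseteq># mset L"
      using "is" True by (simp add: subset_eq_diff_conv)
    ultimately show ?thesis using q(2)[of "remove1 i is" x] x e'(2) by simp
  next
    case False
    then have "mset is \<subseteq># mset L"
      using "is" by (metis diff_single_trivial mset.simps(2) set_mset_mset subset_eq_diff_conv
          add_mset_add_single)
    then have "norm (pd i (pds is w) y) \<le> e'" if "y \<in> {x. \<forall>j. a \<le> x $ j \<and> x $ j \<le> b}" for y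
      using q(2)[OF _ that, of "is"] pds_pd_commute[OF open_UNIV w, of y "is" i] pd_w by simp
    then have "norm (pds is w x) \<le> e' * (b - a)"
      using pds_zero_on_hyperplane[OF w w0 False] x w
      by (intro norm_le_of_zero_on_hyperplane[where i = i])
        (auto intro: smooth_on_differentiable smooth_on_pds)
    then show ?thesis using e'(3) by simp
  qed
  then show ?case using p(1) unfolding w_def by blast
qed

text \<open>
  For a compact subset of an arbitrary open set, a cut-off function reduces the claim to a box; the
  list \<open>L\<close> has every direction at least \<open>l\<close> times.
\<close>

lemma polynomial_approx_derivatives:
  fixes F :: "real ^ 'm::finite \<Rightarrow> 'v::euclidean_space"
  assumes V: "open V" and F: "smooth_on V F" and K: "compact K" "K \<subseteq> V" and e: "e > 0"
  obtains p where "polynomial_function p"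
    "\<And>is x. length is \<le> l \<Longrightarrow> x \<in> K \<Longrightarrow> norm (pds is (\<lambda>x. F x - p x) x) \<le> e"
proof -
  obtain \<eta> N S where \<eta>: "smooth_on UNIV \<eta>" "open N" "K \<subseteq> N" "\<And>x. x \<in> N \<Longrightarrow> \<eta> x = (1::real)"
    "compact S" "S \<subseteq> V" "\<And>x. x \<notin> S \<Longrightarrow> \<eta> x = 0"
    using smooth_cutoff[OF K(1) V K(2)] by blast
  define u where "u x = (if x \<in> V then \<eta> x *\<^sub>R F x else 0)" for x
  have u0: "u x = 0" if "x \<notin> S" for x using \<eta>(7)[OF that] by (simp add: u_def)
  have "smooth_on V u"
    by (rule smooth_on_cong[OF V, of "\<lambda>x. \<eta> x *\<^sub>R F x"])
      (use V F \<eta>(1) in \<open>auto simp: u_def intro: smooth_on_scaleR smooth_on_subset\<close>)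
  moreover have "smooth_on (- S) u"
    by (rule smooth_on_cong[of _ "\<lambda>x. 0"]) (use u0 \<eta>(5) in \<open>auto simp: compact_imp_closed\<close>)
  ultimately have "smooth_on (V \<union> - S) u" by (rule smooth_on_Un)
  moreover have "V \<union> - S = UNIV" using \<eta>(6) by blast
  ultimately have u: "smooth_on UNIV u" by simp
  obtain R where R: "R > 0" "\<And>x. x \<in> S \<union> K \<Longrightarrow> norm x \<le> R"
    using compact_imp_bounded[OF compact_Un[OF \<eta>(5) K(1)]] unfolding bounded_pos by metis
  have comp: "- (R + 1) < x $ j" "x $ j < R + 1" if "x \<in> S \<union> K" for x j
    using R(2)[OF that] component_le_norm_cart[of x j] by auto
  obtain L where L: "mset L = (\<Sum>j\<in>(UNIV::'m set). replicate_mset l j)" using ex_mset by blast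
  have sub: "mset is \<subseteq># mset L" if "length is \<le> l" for "is"
    unfolding subseteq_mset_def
  proof
    fix j
    have "count (mset is) j \<le> length is" by (metis count_le_size size_mset)
    also have "\<dots> \<le> count (mset L) j"
      using that by (simp add: L count_sum)
    finally show "count (mset is) j \<le> count (mset L) j" .
  qed
  have below: "- (R + 1) < x $ i" if "x \<in> S" for x i using comp(1) that by blast
  have "- (R + 1) < R + 1" using R(1) by simp
  from polynomial_approx_box[OF u compact_imp_closed[OF \<eta>(5)] u0 below this e, where L = L]
  obtain p where p: "polynomial_function p" "\<And>is x. mset is \<subseteq># mset L \<Longrightarrow>
      x \<in> {x. \<forall>j. - (R + 1) \<le> x $ j \<and> x $ j \<le> R + 1} \<Longrightarrow> norm (pds is (\<lambda>x. u x - p x) x) \<le> e"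
    by blast
  show ?thesis
  proof (rule that[OF p(1)])
    fix "is" x assume "is": "length (is :: 'm list) \<le> l" and x: "x \<in> K"
    have "pds is (\<lambda>x. F x - p x) x = pds is (\<lambda>x. u x - p x) x"
      by (rule pds_cong[of "N \<inter> V"]) (use x \<eta> K V in \<open>auto simp: u_def\<close>)
    moreover have "x \<in> {x. \<forall>j. - (R + 1) \<le> x $ j \<and> x $ j \<le> R + 1}"
      using comp[of x] x by (auto intro: less_imp_le)
    ultimately show "norm (pds is (\<lambda>x. F x - p x) x) \<le> e" using p(2)[OF sub[OF "is"]] by simp
  qed
qed


section \<open>Functions in a chart\<close>

definition pullback :: "('x, 'm::finite) chart \<Rightarrow> (real ^ 'm \<Rightarrow> 'v::zero) \<Rightarrow> 'x \<Rightarrow> 'v" where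
  "pullback c G p = (if p \<in> chart_dom c then G (chart_map c p) else 0)"

locale coordinate_chart =
  fixes c :: "('x::topological_space, 'm::finite) chart"
  assumes is_chart: "is_chart c"
begin

abbreviation "V \<equiv> chart_map c ` chart_dom c"

lemma open_V: "open V"
  using is_chart by (simp add: is_chart_def)

lemma chart_inv_map: "p \<in> chart_dom c \<Longrightarrow> chart_inv c (chart_map c p) = p"
  and chart_inv_in: "y \<in> V \<Longrightarrow> chart_inv c y \<in> chart_dom c"
  and chart_map_inv: "y \<in> V \<Longrightarrow> chart_map c (chart_inv c y) = y"
  and continuous_on_chart_map: "continuous_on (chart_dom c) (chart_map c)"
  using is_chart by (auto simp: is_chart_def homeomorphism_def inv_into_into f_inv_into_f)

lemma chart_derivs_eq_pds:
  fixes g :: "'x \<Rightarrow> 'v::real_normed_vector"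
  assumes "p \<in> chart_dom c"
  shows "chart_derivs c is g p = pds is (g \<circ> chart_inv c) (chart_map c p)"
  using assms
proof (induction "is" arbitrary: p)
  case Nil
  then show ?case by (simp add: chart_derivs_def chart_inv_map)
next
  case (Cons i "is")
  have "chart_derivs c (i # is) g p = pd i (chart_derivs c is g \<circ> chart_inv c) (chart_map c p)"
    by (simp add: chart_derivs_def chart_deriv_def pd_def)
  also have "\<dots> = pd i (pds is (g \<circ> chart_inv c)) (chart_map c p)"
  proof (rule pd_cong[OF open_V])
    show "(chart_derivs c is g \<circ> chart_inv c) y = pds is (g \<circ> chart_inv c) y" if "y \<in> V" for y
      by (simp only: o_apply[of "chart_derivs c is g"] Cons.IH[OF chart_inv_in[OF that]] chart_map_inv[OF that])
  qed (use Cons.prems in simp)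
  finally show ?case by (simp only: pds_Cons)
qed

lemma smooth_in_iff: "smooth_in c (chart_dom c) g \<longleftrightarrow> smooth_on V (g \<circ> chart_inv c)"
proof -
  have "(chart_derivs c is g \<circ> chart_inv c) differentiable at (chart_map c p) \<longleftrightarrow>
      pds is (g \<circ> chart_inv c) differentiable at (chart_map c p)" if "p \<in> chart_dom c" for p "is"
    unfolding differentiable_def
    using differentiable_cong_open[of V "chart_map c p" "chart_derivs c is g \<circ> chart_inv c"
        "pds is (g \<circ> chart_inv c)"] open_V that
      chart_derivs_eq_pds[of "chart_inv c _" "is" g] chart_inv_in chart_map_inv
    by auto
  then show ?thesis by (auto simp: smooth_in_def smooth_on_iff_pds)
qed

lemma pullback_inv: "y \<in> V \<Longrightarrow> (pullback c G \<circ> chart_inv c) y = G y"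
  using chart_inv_in[of y] chart_map_inv[of y] by (simp add: pullback_def)

lemma pullback_chart_inv:
  "(\<And>p. p \<notin> chart_dom c \<Longrightarrow> g p = 0) \<Longrightarrow> pullback c (g \<circ> chart_inv c) = g"
  by (auto simp: pullback_def chart_inv_map fun_eq_iff)

lemma pullback_eq_iff: "pullback c F = pullback c G \<longleftrightarrow> (\<forall>x\<in>V. F x = G x)"
  by (auto simp: pullback_def fun_eq_iff)

lemma chart_derivs_pullback:
  fixes G :: "real ^ 'm \<Rightarrow> 'v::real_normed_vector"
  assumes "p \<in> chart_dom c"
  shows "chart_derivs c is (pullback c G) p = pds is G (chart_map c p)"
  unfolding chart_derivs_eq_pds[OF assms]
  by (rule pds_cong[OF open_V]) (use assms pullback_inv in blast)+

lemma smooth_in_pullback: "smooth_in c (chart_dom c) (pullback c G) \<longleftrightarrow> smooth_on V G"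
  unfolding smooth_in_iff
  using smooth_on_cong[OF open_V, of "pullback c G \<circ> chart_inv c" G]
    smooth_on_cong[OF open_V, of G "pullback c G \<circ> chart_inv c"] pullback_inv by metis

lemma formal_smooth_pullback:
  "(\<lambda>k. pullback c (F k)) \<in> formal_smooth c \<longleftrightarrow> (\<forall>k. smooth_on V (F k))"
  unfolding formal_smooth_def by (simp add: smooth_in_pullback) (simp add: pullback_def)

lemma formal_smoothE:
  assumes "f \<in> formal_smooth c"
  obtains F where "f = (\<lambda>k. pullback c (F k))" "\<And>k. smooth_on V (F k)"
proof (rule that)
  have "pullback c (f k \<circ> chart_inv c) = f k" for k
    using assms by (intro pullback_chart_inv) (simp add: formal_smooth_def)
  then show "f = (\<lambda>k. pullback c (f k \<circ> chart_inv c))" by simp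
  show "smooth_on V (f k \<circ> chart_inv c)" for k
    using assms by (simp add: formal_smooth_def smooth_in_iff)
qed

end


section \<open>Flat sections and the star product\<close>

text \<open>
  The fibrewise Taylor expansion \<open>\<Sum>\<^sub>M \<partial>\<^sub>M G(x) y\<^sup>M / M!\<close>, i.e. \<open>G(x + y)\<close>.  By the symmetry of higher
  derivatives the ordering of \<open>M\<close> that is picked does not matter.
\<close>

definition jet :: "(real ^ 'm::finite \<Rightarrow> 'k::real_normed_field) \<Rightarrow> real ^ 'm \<Rightarrow> ('m, 'k) sym_series" where
  "jet G x M = pds (SOME l. mset l = M) G x / of_nat (\<Prod>i\<in>UNIV. fact (count M i))"

lemma jet_eq:
  fixes G :: "real ^ 'm::finite \<Rightarrow> 'k::{real_normed_field,euclidean_space}"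
  assumes "open V" "smooth_on V G" "x \<in> V"
  shows "jet G x (mset l) = pds l G x / of_nat (\<Prod>i\<in>UNIV. fact (count (mset l) i))"
proof -
  have "mset (SOME l'. mset l' = mset l) = mset l" by (rule someI) simp
  from pds_permute[OF assms this] show ?thesis by (simp only: jet_def)
qed

lemma jet_empty: "jet G x {#} = G x"
  by (simp add: jet_def)

lemma prod_fact_add_mset:
  "(\<Prod>j\<in>(UNIV::'m set). fact (count (add_mset i M) j)) = Suc (count M i) * (\<Prod>j\<in>(UNIV::'m::finite set). fact (count M j))"
proof -
  have "(\<Prod>j\<in>UNIV. fact (count (add_mset i M) j)) =
      (\<Prod>j\<in>(UNIV::'m set). (if j = i then Suc (count M i) else 1) * fact (count M j))"
    by (rule prod.cong) auto
  then show ?thesis by (simp add: prod.distrib)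
qed

lemma y_deriv_jet:
  fixes G :: "real ^ 'm::finite \<Rightarrow> 'k::{real_normed_field,euclidean_space}"
  assumes V: "open V" and "smooth_on V G" "x \<in> V"
  shows "y_deriv i (jet G x) = jet (pd i G) x"
proof
  fix M :: "'m multiset"
  obtain l where l: "mset l = M" using ex_mset by blast
  have "add_mset i M = mset (l @ [i])" using l by simp
  then have "jet G x (add_mset i M) = pds l (pd i G) x / of_nat (\<Prod>j\<in>UNIV. fact (count (add_mset i M) j))"
    using jet_eq[OF assms, of "l @ [i]"] by (simp add: pds_snoc)
  moreover have "jet (pd i G) x M = pds l (pd i G) x / of_nat (\<Prod>j\<in>UNIV. fact (count M j))"
    using jet_eq[OF V smooth_on_pd[OF assms(2)] assms(3), of i l] l by simp
  moreover have "(\<Prod>j\<in>UNIV. fact (count M j) :: nat) \<noteq> 0" by simp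
  ultimately show "y_deriv i (jet G x) M = jet (pd i G) x M"
    unfolding y_deriv_def
    by (simp only: prod_fact_add_mset of_nat_mult) (simp del: of_nat_Suc of_nat_prod)
qed

text \<open>\<open>bidiff P r F G\<close> is \<open>(P\<^sup>i\<^sup>j \<partial>/\<partial>u\<^sup>i \<partial>/\<partial>v\<^sup>j)\<^sup>r F(u) G(v)\<close> at \<open>u = v = x\<close>.\<close>

primrec bidiff :: "real ^ 'm ^ 'm \<Rightarrow> nat \<Rightarrow> (real ^ 'm::finite \<Rightarrow> 'k::real_normed_field) \<Rightarrow>
    (real ^ 'm \<Rightarrow> 'k) \<Rightarrow> real ^ 'm \<Rightarrow> 'k" where
  "bidiff P 0 F G = (\<lambda>x. F x * G x)"
| "bidiff P (Suc r) F G = (\<lambda>x. \<Sum>i\<in>UNIV. \<Sum>j\<in>UNIV. (P $ i $ j) *\<^sub>R bidiff P r (pd i F) (pd j G) x)"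

definition moyal_weyl :: "real ^ 'm ^ 'm \<Rightarrow> (nat \<Rightarrow> real ^ 'm::finite \<Rightarrow> 'k::real_normed_field) \<Rightarrow>
    (nat \<Rightarrow> real ^ 'm \<Rightarrow> 'k) \<Rightarrow> nat \<Rightarrow> real ^ 'm \<Rightarrow> 'k" where
  "moyal_weyl P F G h x =
     (\<Sum>r\<le>h. \<Sum>s\<le>h - r. (1 / (2 ^ r * fact r)) *\<^sub>R bidiff P r (F s) (G (h - r - s)) x)"

lemma smooth_on_bidiff:
  "open V \<Longrightarrow> smooth_on V F \<Longrightarrow> smooth_on V G \<Longrightarrow> smooth_on V (bidiff P r F G)"
  by (induction r arbitrary: F G)
    (auto intro!: smooth_on_mult smooth_on_sum smooth_on_scaleR intro: smooth_on_pd)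

lemma smooth_on_moyal_weyl:
  "open V \<Longrightarrow> (\<And>k. smooth_on V (F k)) \<Longrightarrow> (\<And>k. smooth_on V (G k)) \<Longrightarrow> smooth_on V (moyal_weyl P F G h)"
  unfolding moyal_weyl_def[abs_def]
  by (intro smooth_on_sum smooth_on_scaleR smooth_on_const smooth_on_bidiff) auto

lemma bidiff_zero_left [simp]: "bidiff P r (\<lambda>x. 0) G = (\<lambda>x. 0)"
  by (induction r arbitrary: G) auto

lemma bidiff_zero_right [simp]: "bidiff P r F (\<lambda>x. 0) = (\<lambda>x. 0)"
  by (induction r arbitrary: F) auto

lemma bidiff_const_left: "bidiff P (Suc r) (\<lambda>x. a) G = (\<lambda>x. 0)"
  by simp

lemma y_mult_empty: "y_mult a b {#} = a {#} * b {#}"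
proof -
  have "{N. N \<subseteq># {#}} = {{#} :: 'a multiset}" by auto
  then show ?thesis by (simp add: y_mult_def)
qed

lemma moyal_power_jet:
  fixes F :: "real ^ 'm::finite \<Rightarrow> 'k::{real_normed_field,euclidean_space}"
  assumes "open V" "smooth_on V F" "smooth_on V G" "x \<in> V"
  shows "moyal_power P r (jet F x) (jet G x) {#} = bidiff P r F G x"
  using assms(2,3)
proof (induction r arbitrary: F G)
  case (Suc r)
  then show ?case
    using assms(1,4) by (simp add: y_deriv_jet smooth_on_pd)
qed (simp add: y_mult_empty jet_empty)

lemma moyal_power_zero: "moyal_power P r (\<lambda>M. 0) b = (\<lambda>M. 0)"
proof (induction r arbitrary: b)
  case 0
  show ?case by (simp add: y_mult_def fun_eq_iff)
next
  case (Suc r)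
  have "y_deriv i (\<lambda>M. 0 :: 'b) = (\<lambda>M. 0)" for i :: 'a by (simp add: y_deriv_def fun_eq_iff)
  with Suc show ?case by simp
qed

text \<open>
  A chart in which the Fedosov connection is \<open>d - \<delta>\<close> and the Poisson tensor is a constant matrix.
  The last assumption makes some pair of coordinates not commute: this is where \<open>\<hbar>\<close> comes from as a
  quantum polynomial.
\<close>

locale flat_chart = coordinate_chart c
  for c :: "('x::topological_space, 'm::finite) chart" +
  fixes \<omega> :: "('x, 'm) two_form"
    and \<Gamma> :: "('x, 'm) christoffel"
    and I :: "('x, 'm, 'k::{real_normed_field,euclidean_space}) weyl_form"
    and P :: "real ^ 'm ^ 'm"
  assumes fedosov_D_eq: "\<And>a i p h M. a \<in> weyl_sections c \<Longrightarrow> p \<in> chart_dom c \<Longrightarrow>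
      fedosov_D \<omega> \<Gamma> I c a i p h M = chart_deriv c i (\<lambda>q. a q h M) p - y_deriv i (a p h) M"
    and poisson_eq: "\<And>p. p \<in> chart_dom c \<Longrightarrow> poisson \<omega> c p = P"
    and P_not_symmetric: "\<exists>i j. P $ i $ j \<noteq> P $ j $ i"
begin

definition lift :: "(nat \<Rightarrow> real ^ 'm \<Rightarrow> 'k) \<Rightarrow> 'x \<Rightarrow> ('m, 'k) weyl" where
  "lift F p h M = pullback c (\<lambda>x. jet (F h) x M) p"

lemma smooth_on_jet: "smooth_on V G \<Longrightarrow> smooth_on V (\<lambda>x. jet G x M :: 'k)"
  unfolding jet_def divide_inverse
  by (intro smooth_on_mult open_V smooth_on_pds smooth_on_const)

lemma pd_jet:
  assumes "smooth_on V G" "x \<in> V"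
  shows "pd i (\<lambda>x. jet G x M) x = (jet (pd i G) x M :: 'k)"
proof -
  let ?l = "SOME l. mset l = M"
  have "pds [i] (\<lambda>x. jet G x M) x = pd i (pds ?l G) x / of_nat (\<Prod>i\<in>UNIV. fact (count M i))"
    unfolding jet_def
    using pds_linear_image[OF open_V bounded_linear_divide smooth_on_pds[OF assms(1)] assms(2), of "[i]"]
    by simp
  then show ?thesis
    unfolding jet_def using pds_pd_commute[OF open_V assms] by simp
qed

lemma lift_in_weyl_sections:
  "(\<And>k. smooth_on V (F k)) \<Longrightarrow> lift F \<in> weyl_sections c"
  unfolding weyl_sections_def lift_def[abs_def]
  by (simp add: smooth_in_pullback smooth_on_jet) (simp add: pullback_def)

lemma chart_deriv_lift:
  assumes F: "\<And>k. smooth_on V (F k)" and p: "p \<in> chart_dom c"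
  shows "chart_deriv c i (\<lambda>q. lift F q h M) p = y_deriv i (lift F p h) M"
proof -
  have "chart_deriv c i (\<lambda>q. lift F q h M) p = pd i (\<lambda>x. jet (F h) x M) (chart_map c p)"
    using chart_derivs_pullback[OF p, of "[i]" "\<lambda>x. jet (F h) x M"]
    by (simp add: chart_derivs_def lift_def[abs_def])
  also have "\<dots> = y_deriv i (jet (F h) (chart_map c p)) M"
    using p F by (simp add: pd_jet y_deriv_jet[OF open_V])
  also have "jet (F h) (chart_map c p) = lift F p h"
    using p by (simp add: lift_def pullback_def fun_eq_iff)
  finally show ?thesis .
qed

text \<open>
  Flatness for \<open>d - \<delta>\<close> is a recursion that gives the coefficient of \<open>y\<^sup>i y\<^sup>M\<close> from that of \<open>y\<^sup>M\<close>; so it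
  determines a section by its symbol.
\<close>

lemma flat_lift_pullback:
  assumes F: "\<And>k. smooth_on V (F k)"
  shows "flat_lift \<omega> \<Gamma> I c (\<lambda>k. pullback c (F k)) = lift F"
  unfolding flat_lift_def
proof (rule the_equality)
  show "lift F \<in> flat_sections \<omega> \<Gamma> I c \<and> symbol (lift F) = (\<lambda>k. pullback c (F k))"
  proof
    have "fedosov_D \<omega> \<Gamma> I c (lift F) i p h M = 0" if "p \<in> chart_dom c" for i p h M
      using fedosov_D_eq[OF lift_in_weyl_sections[OF F] that] chart_deriv_lift[OF F that] by simp
    with lift_in_weyl_sections[OF F] show "lift F \<in> flat_sections \<omega> \<Gamma> I c"
      by (simp add: flat_sections_def)
    show "symbol (lift F) = (\<lambda>k. pullback c (F k))"
      by (simp add: fun_eq_iff symbol_def lift_def jet_empty)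
  qed
next
  fix a assume a: "a \<in> flat_sections \<omega> \<Gamma> I c \<and> symbol a = (\<lambda>k. pullback c (F k))"
  then have sec: "a \<in> weyl_sections c" by (simp add: flat_sections_def)
  have rec: "chart_deriv c i (\<lambda>q. a q h M) p = y_deriv i (a p h) M" if "p \<in> chart_dom c" for i p h M
    using a fedosov_D_eq[OF sec that, where i = i and h = h and M = M] that by (simp add: flat_sections_def)
  have "(\<lambda>p. a p h M) = (\<lambda>p. lift F p h M)" for h M
  proof (induction M)
    case empty
    have "a p h {#} = symbol a h p" for p by (simp add: symbol_def)
    then show ?case using a by (simp add: fun_eq_iff lift_def jet_empty)
  next
    case (add i M)
    show ?case
    proof
      fix p
      show "a p h (add_mset i M) = lift F p h (add_mset i M)"
      proof (cases "p \<in> chart_dom c")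
        case True
        have "y_deriv i (a p h) M = y_deriv i (lift F p h) M"
          using rec[OF True, where i = i and h = h and M = M] add
            chart_deriv_lift[OF F True, where i = i and h = h and M = M] by simp
        then show ?thesis by (simp add: y_deriv_def del: of_nat_Suc)
      next
        case False
        then show ?thesis using sec by (simp add: weyl_sections_def lift_def pullback_def)
      qed
    qed
  qed
  then show "a = lift F" by (simp add: fun_eq_iff)
qed

lemma star_pullback:
  assumes F: "\<And>k. smooth_on V (F k)" and G: "\<And>k. smooth_on V (G k)"
  shows "star \<omega> \<Gamma> I c (\<lambda>k. pullback c (F k)) (\<lambda>k. pullback c (G k)) = (\<lambda>k. pullback c (moyal_weyl P F G k))"
proof (intro ext)
  fix h p
  show "star \<omega> \<Gamma> I c (\<lambda>k. pullback c (F k)) (\<lambda>k. pullback c (G k)) h p = pullback c (moyal_weyl P F G h) p"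
  proof (cases "p \<in> chart_dom c")
    case True
    have lift: "lift H p s = jet (H s) (chart_map c p)" for H s
      using True by (simp add: lift_def pullback_def fun_eq_iff)
    have "moyal_power P r (jet (F s) (chart_map c p)) (jet (G t) (chart_map c p)) {#}
        = bidiff P r (F s) (G t) (chart_map c p)" for r s t
      using True by (intro moyal_power_jet[OF open_V F G]) simp
    then show ?thesis
      using True by (simp add: star_def symbol_def flat_lift_pullback F G poisson_eq moyal_def lift
          pullback_def moyal_weyl_def)
  next
    case False
    then have "lift F p s = (\<lambda>M. 0)" for s
      by (simp add: lift_def pullback_def fun_eq_iff)
    with False show ?thesis
      by (simp add: star_def symbol_def flat_lift_pullback F G moyal_def moyal_power_zero pullback_def)
  qed
qed

end


section \<open>Derivatives of functions that vanish from a given order on\<close>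

text \<open>
  The order is an integer since derivation lowers it by one without a bound: so the same arithmetic
  holds for a function that is zero.
\<close>

definition derivs_vanish_from :: "int \<Rightarrow> (real ^ 'm::finite) set \<Rightarrow> (real ^ 'm \<Rightarrow> 'v::real_normed_vector) \<Rightarrow> bool" where
  "derivs_vanish_from w V G \<longleftrightarrow> (\<forall>is. \<forall>x\<in>V. w \<le> int (length is) \<longrightarrow> pds is G x = 0)"

lemma derivs_vanish_from_pd:
  "derivs_vanish_from w V G \<Longrightarrow> derivs_vanish_from (w - 1) V (pd i G)"
  unfolding derivs_vanish_from_def pds_snoc[symmetric] by simp

lemma derivs_vanish_from_mono:
  "derivs_vanish_from w V G \<Longrightarrow> w \<le> w' \<Longrightarrow> derivs_vanish_from w' V G"
  unfolding derivs_vanish_from_def by auto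

lemma derivs_vanish_from_sum:
  assumes "open V" "\<And>a. a \<in> A \<Longrightarrow> smooth_on V (F a)" "\<And>a. a \<in> A \<Longrightarrow> derivs_vanish_from w V (F a)"
  shows "derivs_vanish_from w V (\<lambda>x. \<Sum>a\<in>A. F a x)"
  using assms(3) unfolding derivs_vanish_from_def by (simp add: pds_sum[OF assms(1,2)])

lemma derivs_vanish_from_linear_image:
  assumes "open V" "bounded_linear f" "smooth_on V F" "derivs_vanish_from w V F"
  shows "derivs_vanish_from w V (\<lambda>x. f (F x))"
  using assms(4) unfolding derivs_vanish_from_def
  by (simp add: pds_linear_image[OF assms(1-3)] linear_0[OF bounded_linear.linear[OF assms(2)]])

text \<open>By the Leibniz rule; for polynomials this is the additivity of degrees.\<close>

lemma derivs_vanish_from_mult: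
  fixes F G :: "real ^ 'm::finite \<Rightarrow> 'k::real_normed_field"
  assumes V: "open V" and "smooth_on V F" "smooth_on V G"
    "derivs_vanish_from w1 V F" "derivs_vanish_from w2 V G"
  shows "derivs_vanish_from (w1 + w2 - 1) V (\<lambda>x. F x * G x)"
proof -
  have "pds is (\<lambda>x. F x * G x) x = 0" if "w1 + w2 - 1 \<le> int (length is)" "x \<in> V" for "is" x
    using assms(2-) that
  proof (induction "is" arbitrary: F G w1 w2 x rule: rev_induct)
    case Nil
    then have "w1 \<le> 0 \<or> w2 \<le> 0" by auto
    moreover have "F x = 0" if "w1 \<le> 0"
      using Nil that unfolding derivs_vanish_from_def by (metis list.size(3) of_nat_0 pds_Nil)
    moreover have "G x = 0" if "w2 \<le> 0"
      using Nil that unfolding derivs_vanish_from_def by (metis list.size(3) of_nat_0 pds_Nil)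
    ultimately show ?case by auto
  next
    case (snoc i "is")
    note sm = snoc.prems(1,2) smooth_on_pd[OF snoc.prems(1), of i] smooth_on_pd[OF snoc.prems(2), of i]
    have "pds (is @ [i]) (\<lambda>x. F x * G x) x = pds is (\<lambda>x. F x * pd i G x + pd i F x * G x) x"
      unfolding pds_snoc
    proof (rule pds_cong[OF V snoc.prems(6)])
      show "pd i (\<lambda>x. F x * G x) y = F y * pd i G y + pd i F y * G y" if "y \<in> V" for y
        using that snoc.prems(1,2)
        by (intro differentiable_bilinear(2)[OF bounded_bilinear_mult] smooth_on_differentiable[of V])
    qed
    also have "\<dots> = pds is (\<lambda>x. F x * pd i G x) x + pds is (\<lambda>x. pd i F x * G x) x"
      by (rule pds_add[OF V _ _ snoc.prems(6)]) (intro smooth_on_mult V sm)+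
    also have "pds is (\<lambda>x. F x * pd i G x) x = 0"
      by (rule snoc.IH[OF sm(1) sm(4) snoc.prems(3) derivs_vanish_from_pd[OF snoc.prems(4)] _ snoc.prems(6)])
        (use snoc.prems(5) in simp)
    also have "pds is (\<lambda>x. pd i F x * G x) x = 0"
      by (rule snoc.IH[OF sm(3) sm(2) derivs_vanish_from_pd[OF snoc.prems(3)] snoc.prems(4) _ snoc.prems(6)])
        (use snoc.prems(5) in simp)
    finally show ?case by simp
  qed
  then show ?thesis by (simp add: derivs_vanish_from_def)
qed

lemma derivs_vanish_from_bidiff:
  fixes F G :: "real ^ 'm::finite \<Rightarrow> 'k::real_normed_field"
  assumes V: "open V" and "smooth_on V F" "smooth_on V G"
    "derivs_vanish_from w1 V F" "derivs_vanish_from w2 V G"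
  shows "derivs_vanish_from (w1 + w2 - 1 - 2 * int r) V (bidiff P r F G)"
  using assms(2-)
proof (induction r arbitrary: F G w1 w2)
  case 0
  then show ?case using derivs_vanish_from_mult[OF V] by simp
next
  case (Suc r)
  have "derivs_vanish_from ((w1 - 1) + (w2 - 1) - 1 - 2 * int r) V (bidiff P r (pd i F) (pd j G))" for i j
    using Suc.prems by (intro Suc.IH smooth_on_pd derivs_vanish_from_pd)
  moreover have "(w1 - 1) + (w2 - 1) - 1 - 2 * int r = w1 + w2 - 1 - 2 * int (Suc r)" by simp
  ultimately show ?case
    unfolding bidiff.simps using Suc.prems(1,2)
    by (intro derivs_vanish_from_sum[OF V] derivs_vanish_from_linear_image[OF V bounded_linear_scaleR_right]
        smooth_on_sum[OF V] smooth_on_scaleR[OF V] smooth_on_bidiff[OF V] smooth_on_pd smooth_on_const) metis+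
qed

text \<open>
  \<open>\<hbar>\<close> counts twice as much as \<open>x\<^sup>i\<close>, and the Moyal-Weyl product takes two derivatives for every \<open>\<hbar>\<close>: so it
  respects the weights.
\<close>

lemma derivs_vanish_from_moyal_weyl:
  fixes F G :: "nat \<Rightarrow> real ^ 'm::finite \<Rightarrow> 'k::real_normed_field"
  assumes V: "open V" and F: "\<And>k. smooth_on V (F k)" and G: "\<And>k. smooth_on V (G k)"
    and "\<And>k. derivs_vanish_from (w1 - 2 * int k) V (F k)" "\<And>k. derivs_vanish_from (w2 - 2 * int k) V (G k)"
  shows "derivs_vanish_from (w1 + w2 - 1 - 2 * int h) V (moyal_weyl P F G h)"
proof -
  have "derivs_vanish_from (w1 + w2 - 1 - 2 * int h) V (bidiff P r (F s) (G (h - r - s)))"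
    if "r \<le> h" "s \<le> h - r" for r s
    using derivs_vanish_from_bidiff[OF V F G assms(4)[of s] assms(5)[of "h - r - s"], of r P]
    by (rule derivs_vanish_from_mono) (use that in auto)
  then show ?thesis
    unfolding moyal_weyl_def[abs_def]
    by (intro derivs_vanish_from_sum[OF V] derivs_vanish_from_linear_image[OF V bounded_linear_scaleR_right]
        smooth_on_sum[OF V] smooth_on_scaleR[OF V] smooth_on_bidiff[OF V F G] smooth_on_const) auto
qed


section \<open>Quantum polynomials\<close>

definition at_order :: "nat \<Rightarrow> (real ^ 'm \<Rightarrow> 'k) \<Rightarrow> nat \<Rightarrow> real ^ 'm \<Rightarrow> 'k::zero" where
  "at_order k0 G k = (if k = k0 then G else (\<lambda>x. 0))"

lemma at_order_zero [simp]: "at_order k0 (\<lambda>x. 0) = (\<lambda>k x. 0)"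
  by (simp add: at_order_def fun_eq_iff)

definition coord :: "'m \<Rightarrow> real ^ 'm::finite \<Rightarrow> 'k::real_normed_field" where
  "coord i x = of_real (x $ i)"

lemma bounded_linear_coord: "bounded_linear (coord i)"
  unfolding coord_def[abs_def]
  by (rule bounded_linear_compose[OF bounded_linear_of_real bounded_linear_vec_nth])

lemma pd_coord: "pd j (coord i) = (\<lambda>x. if i = j then 1 else 0)"
  unfolding pd_linear[OF bounded_linear_coord] by (auto simp: coord_def axis_def fun_eq_iff)

lemma smooth_on_coord: "smooth_on V (coord i)"
  by (rule smooth_on_linear[OF bounded_linear_coord])

lemma moyal_weyl_order_0:
  "moyal_weyl P (at_order 0 F) (at_order 0 G) h x = (1 / (2 ^ h * fact h)) *\<^sub>R bidiff P h F G x"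
proof -
  have "(1 / (2 ^ r * fact r)) *\<^sub>R bidiff P r (at_order 0 F s) (at_order 0 G (h - r - s)) x
      = (if s = 0 then if r = h then (1 / (2 ^ r * fact r)) *\<^sub>R bidiff P r F G x else 0 else 0)"
    if "r \<le> h" for r s using that by (auto simp: at_order_def)
  then have "moyal_weyl P (at_order 0 F) (at_order 0 G) h x =
    (\<Sum>r\<le>h. \<Sum>s\<le>h - r. if s = 0 then if r = h then (1 / (2 ^ r * fact r)) *\<^sub>R bidiff P r F G x else 0 else 0)"
    unfolding moyal_weyl_def by (intro sum.cong refl) auto
  also have "\<dots> = (\<Sum>r\<le>h. if r = h then (1 / (2 ^ r * fact r)) *\<^sub>R bidiff P r F G x else 0)"
    by (intro sum.cong refl) (simp add: sum.delta)
  finally show ?thesis by (simp add: sum.delta)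
qed

lemma bidiff_coord:
  "bidiff P 1 (coord i) G x = (\<Sum>b\<in>UNIV. (P $ i $ b) *\<^sub>R pd b G x)"
  "bidiff P (Suc (Suc r)) (coord i) G x = 0"
proof -
  have "bidiff P 1 (coord i) G x = (\<Sum>a\<in>UNIV. if i = a then \<Sum>b\<in>UNIV. (P $ a $ b) *\<^sub>R pd b G x else 0)"
    unfolding One_nat_def bidiff.simps pd_coord by (intro sum.cong refl) auto
  then show "bidiff P 1 (coord i) G x = (\<Sum>b\<in>UNIV. (P $ i $ b) *\<^sub>R pd b G x)" by simp
  show "bidiff P (Suc (Suc r)) (coord i) G x = 0"
    unfolding bidiff.simps(2)[of P "Suc r"] pd_coord by (simp add: bidiff_const_left del: bidiff.simps)
qed

lemma moyal_weyl_coord: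
  "moyal_weyl P (at_order 0 (coord i)) (at_order 0 G) h x =
     (if h = 0 then coord i x * G x
      else if h = 1 then (1 / 2) *\<^sub>R (\<Sum>b\<in>UNIV. (P $ i $ b) *\<^sub>R pd b G x) else 0)"
proof -
  consider "h = 0" | "h = 1" | r where "h = Suc (Suc r)" by (metis One_nat_def not0_implies_Suc)
  then show ?thesis
    by cases (auto simp: moyal_weyl_order_0 bidiff_coord simp del: bidiff.simps(2) One_nat_def)
qed

lemma moyal_weyl_hbar:
  fixes G :: "nat \<Rightarrow> real ^ 'm::finite \<Rightarrow> 'k::real_normed_field"
  shows "moyal_weyl P (at_order 1 (\<lambda>x. 1)) G h x = (if h = 0 then 0 else G (h - 1) x)"
proof -
  have *: "(\<Sum>s\<le>h - r. (1 / (2 ^ r * fact r)) *\<^sub>R bidiff P r (at_order 1 (\<lambda>x. 1) s) (G (h - r - s)) x)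
      = (if r = 0 then if h = 0 then 0 else G (h - 1) x else 0)" for r
  proof (cases r)
    case 0
    have "(\<Sum>s\<le>h. at_order 1 (\<lambda>x. 1) s x * G (h - s) x) = (\<Sum>s\<le>h. if s = 1 then G (h - s) x else 0)"
      by (intro sum.cong refl) (auto simp: at_order_def)
    then show ?thesis by (auto simp: 0 sum.delta)
  next
    case (Suc r')
    have "bidiff P r (at_order 1 (\<lambda>x. 1) s) G' = (\<lambda>x. 0)" for s and G' :: "real ^ 'm \<Rightarrow> 'k"
      by (simp add: Suc at_order_def)
    with Suc show ?thesis by (simp del: bidiff.simps)
  qed
  show ?thesis unfolding moyal_weyl_def * by simp
qed

context flat_chart
begin

abbreviation "QP \<equiv> quantum_polynomials \<omega> \<Gamma> I c"

lemma formal_of_one: "formal_of c (\<lambda>_. 1) = (\<lambda>k. pullback c (at_order 0 (\<lambda>x. 1) k))"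
  and formal_of_coord:
    "formal_of c (\<lambda>p. of_real (chart_map c p $ i)) = (\<lambda>k. pullback c (at_order 0 (coord i) k))"
  by (auto simp: formal_of_def pullback_def at_order_def coord_def fun_eq_iff)

lemma smooth_on_at_order: "smooth_on V G \<Longrightarrow> smooth_on V (at_order k0 G k)"
  by (simp add: at_order_def)

lemma quantum_polynomial_bounded_weight:
  assumes "f \<in> QP"
  shows "\<exists>F w. f = (\<lambda>k. pullback c (F k)) \<and> (\<forall>k. smooth_on V (F k)) \<and>
    (\<forall>k. derivs_vanish_from (w - 2 * int k) V (F k))"
  using assms
proof (induction rule: quantum_polynomials.induct)
  case one
  have "derivs_vanish_from (1 - 2 * int k) V (at_order 0 (\<lambda>x. 1 :: 'k) k)" for k
  proof -
    have "pds is (\<lambda>x. 1 :: 'k) = (\<lambda>x. 0)" if "1 \<le> length is" for "is" :: "'m list"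
      using that by (cases "is" rule: rev_cases) (simp_all add: pds_snoc)
    then show ?thesis by (simp add: derivs_vanish_from_def at_order_def)
  qed
  then show ?case
    by (intro exI[of _ "at_order 0 (\<lambda>x. 1)"] exI[of _ 1]) (simp add: formal_of_one smooth_on_at_order)
next
  case (coord i)
  have "derivs_vanish_from (2 - 2 * int k) V (at_order 0 (coord i :: _ \<Rightarrow> 'k) k)" for k
  proof -
    have "pds is (coord i :: _ \<Rightarrow> 'k) = (\<lambda>x. 0)" if len: "2 \<le> length is" for "is" :: "'m list"
    proof -
      obtain ks b where ks: "is = ks @ [b]" using len by (cases "is" rule: rev_cases) auto
      moreover obtain js a where "ks = js @ [a]" using len ks by (cases ks rule: rev_cases) auto
      ultimately show ?thesis by (simp add: pds_append pd_coord)
    qed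
    then show ?thesis by (simp add: derivs_vanish_from_def at_order_def)
  qed
  then show ?case
    by (intro exI[of _ "at_order 0 (coord i)"] exI[of _ 2])
      (simp add: formal_of_coord smooth_on_at_order smooth_on_coord)
next
  case (scale f s)
  then obtain F w where F: "f = (\<lambda>k. pullback c (F k))" "\<And>k. smooth_on V (F k)"
    "\<And>k. derivs_vanish_from (w - 2 * int k) V (F k)" by blast
  have "(\<lambda>k p. s * f k p) = (\<lambda>k. pullback c (\<lambda>x. s * F k x))"
    by (simp add: F(1) pullback_def fun_eq_iff)
  moreover have "derivs_vanish_from (w - 2 * int k) V (\<lambda>x. s * F k x)" for k
    by (rule derivs_vanish_from_linear_image[OF open_V bounded_linear_mult_right F(2,3)])
  ultimately show ?case
    using F(2) open_V by (intro exI[of _ "\<lambda>k x. s * F k x"] exI[of _ w]) (simp add: smooth_on_mult)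
next
  case (add f g)
  then obtain F w where F: "f = (\<lambda>k. pullback c (F k))" "\<And>k. smooth_on V (F k)"
    "\<And>k. derivs_vanish_from (w - 2 * int k) V (F k)" by blast
  obtain G w' where G: "g = (\<lambda>k. pullback c (G k))" "\<And>k. smooth_on V (G k)"
    "\<And>k. derivs_vanish_from (w' - 2 * int k) V (G k)" using add by blast
  have "(\<lambda>k p. f k p + g k p) = (\<lambda>k. pullback c (\<lambda>x. F k x + G k x))"
    by (simp add: F(1) G(1) pullback_def fun_eq_iff)
  moreover have "derivs_vanish_from (max w w' - 2 * int k) V (\<lambda>x. F k x + G k x)" for k
    using F(3)[of k] G(3)[of k] unfolding derivs_vanish_from_def
    by (simp add: pds_add[OF open_V F(2) G(2)])
  ultimately show ?case
    using F(2) G(2) open_V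
    by (intro exI[of _ "\<lambda>k x. F k x + G k x"] exI[of _ "max w w'"]) (simp add: smooth_on_add)
next
  case (mult f g)
  then obtain F w where F: "f = (\<lambda>k. pullback c (F k))" "\<And>k. smooth_on V (F k)"
    "\<And>k. derivs_vanish_from (w - 2 * int k) V (F k)" by blast
  obtain G w' where G: "g = (\<lambda>k. pullback c (G k))" "\<And>k. smooth_on V (G k)"
    "\<And>k. derivs_vanish_from (w' - 2 * int k) V (G k)" using mult by blast
  show ?case
    unfolding F(1) G(1) star_pullback[OF F(2) G(2)]
    using smooth_on_moyal_weyl[OF open_V F(2) G(2)]
      derivs_vanish_from_moyal_weyl[OF open_V F(2) G(2) F(3) G(3)]
    by (intro exI[of _ "moyal_weyl P F G"] exI[of _ "w + w' - 1"]) auto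
qed

lemma quantum_polynomials_quantizable: "QP \<subseteq> quantizable_functions \<omega> \<Gamma> I c"
proof
  fix f assume "f \<in> QP"
  then obtain F w where F: "f = (\<lambda>k. pullback c (F k))" "\<And>k. smooth_on V (F k)"
    "\<And>k. derivs_vanish_from (w - 2 * int k) V (F k)"
    using quantum_polynomial_bounded_weight by blast
  have "w' < nat w" if ne: "weight_component w' (flat_lift \<omega> \<Gamma> I c f) \<noteq> (\<lambda>_ _ _. 0)" for w'
  proof (rule ccontr)
    assume "\<not> w' < nat w"
    then have w': "w \<le> int w'" by simp
    have "weight_component w' (lift F) p h M = 0" for p h M
    proof (cases "weight h M = w' \<and> p \<in> chart_dom c")
      case True
      obtain l where l: "mset l = M" using ex_mset by blast
      have "length l = size M" using l by auto
      then have "w - 2 * int h \<le> int (length l)"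
        using True w' by (simp add: weight_def)
      then have "pds l (F h) (chart_map c p) = 0"
        using F(3)[of h] True by (simp add: derivs_vanish_from_def)
      then have "jet (F h) (chart_map c p) M = 0"
        using jet_eq[OF open_V F(2), of "chart_map c p" h l] True l by simp
      then show ?thesis by (simp add: weight_component_def lift_def pullback_def)
    qed (auto simp: weight_component_def lift_def pullback_def)
    then show False using ne by (simp add: F flat_lift_pullback fun_eq_iff)
  qed
  then have "{w'. weight_component w' (flat_lift \<omega> \<Gamma> I c f) \<noteq> (\<lambda>_ _ _. 0)} \<subseteq> {..<nat w}" by auto
  then have "finite {w'. weight_component w' (flat_lift \<omega> \<Gamma> I c f) \<noteq> (\<lambda>_ _ _. 0)}"
    by (rule finite_subset) simp
  then show "f \<in> quantizable_functions \<omega> \<Gamma> I c"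
    using F(2) by (simp add: quantizable_functions_def formal_smooth_pullback F(1))
qed

definition qpoly :: "(nat \<Rightarrow> real ^ 'm \<Rightarrow> 'k) \<Rightarrow> bool" where
  "qpoly F \<longleftrightarrow> (\<lambda>k. pullback c (F k)) \<in> QP"

lemma qpoly_smooth: "qpoly F \<Longrightarrow> smooth_on V (F k)"
  using quantum_polynomials_quantizable
  by (auto simp: qpoly_def quantizable_functions_def formal_smooth_pullback)

lemma qpoly_cong: "qpoly F \<Longrightarrow> (\<And>k x. x \<in> V \<Longrightarrow> F k x = G k x) \<Longrightarrow> qpoly G"
  unfolding qpoly_def using pullback_eq_iff[of "F _" "G _"] by (metis (no_types, lifting) ext)

lemma qpoly_one: "qpoly (at_order 0 (\<lambda>x. 1))"
  unfolding qpoly_def using quantum_polynomials.one[of c \<omega> \<Gamma> I] by (simp add: formal_of_one)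

lemma qpoly_coord: "qpoly (at_order 0 (coord i))"
  unfolding qpoly_def using quantum_polynomials.coord[of c i \<omega> \<Gamma> I] by (simp add: formal_of_coord)

lemma qpoly_scale: "qpoly F \<Longrightarrow> qpoly (\<lambda>k x. s * F k x)"
proof -
  have "(\<lambda>k. pullback c (\<lambda>x. s * F k x)) = (\<lambda>k p. s * pullback c (F k) p)"
    by (simp add: pullback_def fun_eq_iff)
  then show "qpoly F \<Longrightarrow> ?thesis" unfolding qpoly_def by (simp add: quantum_polynomials.scale)
qed

lemma qpoly_add: "qpoly F \<Longrightarrow> qpoly G \<Longrightarrow> qpoly (\<lambda>k x. F k x + G k x)"
proof -
  have "(\<lambda>k. pullback c (\<lambda>x. F k x + G k x)) = (\<lambda>k p. pullback c (F k) p + pullback c (G k) p)"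
    by (simp add: pullback_def fun_eq_iff)
  then show "qpoly F \<Longrightarrow> qpoly G \<Longrightarrow> ?thesis" unfolding qpoly_def by (simp add: quantum_polynomials.add)
qed

lemma qpoly_zero: "qpoly (\<lambda>k x. 0)"
  using qpoly_scale[OF qpoly_one, of 0] by simp

lemma qpoly_sum: "(\<And>a. a \<in> A \<Longrightarrow> qpoly (F a)) \<Longrightarrow> qpoly (\<lambda>k x. \<Sum>a\<in>A. F a k x)"
  by (induction A rule: infinite_finite_induct) (auto intro: qpoly_add qpoly_zero)

lemma qpoly_moyal_weyl: "qpoly F \<Longrightarrow> qpoly G \<Longrightarrow> qpoly (moyal_weyl P F G)"
  using quantum_polynomials.mult[of _ \<omega> \<Gamma> I c] star_pullback[of F G] qpoly_smooth[of F] qpoly_smooth[of G]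
  unfolding qpoly_def by metis

text \<open>\<open>\<hbar>\<close> is a multiple of the commutator of two coordinates.\<close>

lemma qpoly_hbar: "qpoly (at_order 1 (\<lambda>x. 1))"
proof -
  obtain i j where ij: "P $ i $ j \<noteq> P $ j $ i" using P_not_symmetric by blast
  define d where "d = (P $ i $ j - P $ j $ i) / 2"
  have *: "moyal_weyl P (at_order 0 (coord a)) (at_order 0 (coord b)) k x =
      (if k = 0 then coord a x * coord b x else if k = 1 then of_real (P $ a $ b / 2) else (0 :: 'k))" for a b k x
  proof -
    have "(\<Sum>d\<in>UNIV. (P $ a $ d) *\<^sub>R (if b = d then 1 else 0 :: 'k)) = (\<Sum>d\<in>UNIV. if b = d then of_real (P $ a $ d) else 0)"
      by (intro sum.cong refl) (simp add: of_real_def)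
    then show ?thesis
      by (simp add: moyal_weyl_coord pd_coord scaleR_conv_of_real)
  qed
  let ?c = "\<lambda>a b. moyal_weyl P (at_order 0 (coord a)) (at_order 0 (coord b))"
  have "qpoly (\<lambda>k x. of_real (1 / d) * (?c i j k x + (- 1) * ?c j i k x))"
    by (intro qpoly_scale qpoly_add qpoly_moyal_weyl qpoly_coord)
  then show ?thesis
  proof (rule qpoly_cong)
    show "of_real (1 / d) * (?c i j k x + (- 1) * ?c j i k x) = at_order 1 (\<lambda>x. 1 :: 'k) k x" for k x
    proof (cases "k = 1")
      case True
      have "(1 / d) * (P $ i $ j / 2 + (- 1) * (P $ j $ i / 2)) = 1"
        using ij by (simp add: d_def field_simps)
      then have "of_real ((1 / d) * (P $ i $ j / 2 + (- 1) * (P $ j $ i / 2))) = (of_real 1 :: 'k)"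
        by (rule arg_cong)
      then have comm: "of_real (1 / d) * (of_real (P $ i $ j / 2) + (- 1) * of_real (P $ j $ i / 2)) = (1 :: 'k)"
        by (simp only: of_real_mult of_real_add of_real_minus of_real_1)
      have "?c a b k x = (of_real (P $ a $ b / 2) :: 'k)" for a b
        by (simp only: *) (simp add: True)
      moreover have "at_order 1 (\<lambda>x. 1 :: 'k) k x = 1" by (simp add: True at_order_def)
      ultimately show ?thesis by (simp only: comm)
    next
      case False
      show ?thesis by (simp only: *) (use False in \<open>simp add: at_order_def mult.commute\<close>)
    qed
  qed
qed

lemma qpoly_hbar_times:
  assumes "qpoly F"
  shows "qpoly (\<lambda>k x. if k = 0 then 0 else F (k - 1) x)"
  by (rule qpoly_cong[OF qpoly_moyal_weyl[OF qpoly_hbar assms]]) (simp only: moyal_weyl_hbar)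

lemma qpoly_at_order: "qpoly (at_order 0 G) \<Longrightarrow> qpoly (at_order k0 G)"
proof (induction k0)
  case (Suc k0)
  from qpoly_hbar_times[OF Suc.IH[OF Suc.prems]] show ?case
    by (rule qpoly_cong) (auto simp: at_order_def)
qed simp

text \<open>
  The star product with a coordinate is \<open>x\<^sup>i \<star> g = x\<^sup>i g + \<hbar>/2 P\<^sup>i\<^sup>b \<partial>\<^sub>b g\<close>, and the correction term can be
  subtracted.
\<close>

lemma qpoly_coord_times:
  assumes "qpoly (at_order 0 g)" "\<And>b. qpoly (at_order 0 (pd b g))"
  shows "qpoly (at_order 0 (\<lambda>x. coord i x * g x))"
proof -
  have "qpoly (\<lambda>k x. moyal_weyl P (at_order 0 (coord i)) (at_order 0 g) k x +
      (\<Sum>b\<in>UNIV. of_real (- (P $ i $ b) / 2) * at_order 1 (pd b g) k x))"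
    by (intro qpoly_add qpoly_sum qpoly_scale qpoly_moyal_weyl qpoly_coord assms qpoly_at_order)
  then show ?thesis
  proof (rule qpoly_cong)
    fix k x
    have "(\<Sum>b\<in>UNIV. of_real (- (P $ i $ b) / 2) * pd b g x) = - ((1 / 2) *\<^sub>R (\<Sum>b\<in>UNIV. (P $ i $ b) *\<^sub>R pd b g x))"
      by (simp add: scaleR_sum_right sum_negf[symmetric] scaleR_conv_of_real[of _ "pd _ g x"])
        (simp add: scaleR_conv_of_real)
    then show "moyal_weyl P (at_order 0 (coord i)) (at_order 0 g) k x +
      (\<Sum>b\<in>UNIV. of_real (- (P $ i $ b) / 2) * at_order 1 (pd b g) k x) = at_order 0 (\<lambda>x. coord i x * g x) k x"
      unfolding moyal_weyl_coord by (simp add: at_order_def)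
  qed
qed

text \<open>
  A class that is closed under derivation and so, by the last lemma and the Leibniz rule, under
  ordinary multiplication by coordinates: it contains all polynomials.
\<close>

definition qpoly_derivs :: "(real ^ 'm \<Rightarrow> 'k) \<Rightarrow> bool" where
  "qpoly_derivs g \<longleftrightarrow> (\<forall>is. qpoly (at_order 0 (pds is g)))"

lemma qpoly_derivs_smooth: "qpoly_derivs g \<Longrightarrow> smooth_on V g"
  using qpoly_smooth[of "at_order 0 g" 0] unfolding qpoly_derivs_def
  by (metis at_order_def pds_Nil)

lemma qpoly_derivs_pd: "qpoly_derivs g \<Longrightarrow> qpoly_derivs (pd i g)"
  unfolding qpoly_derivs_def by (simp flip: pds_snoc)

lemma qpoly_derivs_add:
  assumes "qpoly_derivs g" "qpoly_derivs g'"
  shows "qpoly_derivs (\<lambda>x. g x + g' x)"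
  unfolding qpoly_derivs_def
proof
  fix "is"
  have "qpoly (\<lambda>k x. at_order 0 (pds is g) k x + at_order 0 (pds is g') k x)"
    using assms by (intro qpoly_add) (auto simp: qpoly_derivs_def)
  then show "qpoly (at_order 0 (pds is (\<lambda>x. g x + g' x)))"
    by (rule qpoly_cong) (simp add: at_order_def pds_add[OF open_V] assms qpoly_derivs_smooth)
qed

lemma qpoly_derivs_scale:
  assumes "qpoly_derivs g"
  shows "qpoly_derivs (\<lambda>x. s * g x)"
  unfolding qpoly_derivs_def
proof
  fix "is"
  have "qpoly (\<lambda>k x. s * at_order 0 (pds is g) k x)"
    using assms by (intro qpoly_scale) (auto simp: qpoly_derivs_def)
  then show "qpoly (at_order 0 (pds is (\<lambda>x. s * g x)))"
    by (rule qpoly_cong)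
      (simp add: at_order_def pds_linear_image[OF open_V bounded_linear_mult_right] assms qpoly_derivs_smooth)
qed

lemma qpoly_derivs_one: "qpoly_derivs (\<lambda>x. 1)"
  unfolding qpoly_derivs_def
proof
  fix "is" :: "'m list"
  show "qpoly (at_order 0 (pds is (\<lambda>x. 1)))"
    by (cases "is" rule: rev_cases) (simp_all add: pds_snoc qpoly_one qpoly_zero)
qed

lemma qpoly_derivs_sum:
  "(\<And>a. a \<in> A \<Longrightarrow> qpoly_derivs (g a)) \<Longrightarrow> qpoly_derivs (\<lambda>x. \<Sum>a\<in>A. g a x)"
  using qpoly_derivs_scale[OF qpoly_derivs_one, of 0]
  by (induction A rule: infinite_finite_induct) (auto intro: qpoly_derivs_add)

lemma qpoly_derivs_coord_times:
  assumes "qpoly_derivs g"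
  shows "qpoly_derivs (\<lambda>x. coord i x * g x)"
  unfolding qpoly_derivs_def
proof
  fix "is"
  show "qpoly (at_order 0 (pds is (\<lambda>x. coord i x * g x)))"
    using assms
  proof (induction "is" arbitrary: g rule: rev_induct)
    case Nil
    from Nil[unfolded qpoly_derivs_def, rule_format, of "[]"]
      Nil[unfolded qpoly_derivs_def, rule_format, of "[_]"]
    show ?case using qpoly_coord_times[of g i] by simp
  next
    case (snoc j "is")
    have sm: "smooth_on V g" "smooth_on V (pd j g)"
      using snoc.prems by (auto intro: qpoly_derivs_smooth smooth_on_pd)
    have "qpoly (\<lambda>k x. at_order 0 (pds is (\<lambda>x. coord i x * pd j g x)) k x +
        (if i = j then 1 else 0) * at_order 0 (pds is g) k x)"
      using snoc.IH[OF qpoly_derivs_pd[OF snoc.prems]] snoc.prems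
      by (intro qpoly_add qpoly_scale) (auto simp: qpoly_derivs_def)
    then show ?case
    proof (rule qpoly_cong)
      fix k x assume x: "x \<in> V"
      have "pds (is @ [j]) (\<lambda>x. coord i x * g x) x =
          pds is (\<lambda>x. coord i x * pd j g x + (if i = j then 1 else 0) * g x) x"
        unfolding pds_snoc
      proof (rule pds_cong[OF open_V x])
        fix y assume "y \<in> V"
        from differentiable_bilinear(2)[OF bounded_bilinear_mult
            smooth_on_differentiable[OF smooth_on_coord UNIV_I] smooth_on_differentiable[OF sm(1) this]]
        show "pd j (\<lambda>x. coord i x * g x) y = coord i y * pd j g y + (if i = j then 1 else 0) * g y"
          by (simp add: pd_coord)
      qed
      also have "\<dots> = pds is (\<lambda>x. coord i x * pd j g x) x + pds is (\<lambda>x. (if i = j then 1 else 0) * g x) x"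
        by (rule pds_add[OF open_V _ _ x]) (intro smooth_on_mult open_V smooth_on_coord smooth_on_const sm)+
      also have "pds is (\<lambda>x. (if i = j then 1 else 0) * g x) x = (if i = j then 1 else 0) * pds is g x"
        by (rule pds_linear_image[OF open_V bounded_linear_mult_right sm(1) x])
      finally show "at_order 0 (pds is (\<lambda>x. coord i x * pd j g x)) k x +
          (if i = j then 1 else 0) * at_order 0 (pds is g) k x =
          at_order 0 (pds (is @ [j]) (\<lambda>x. coord i x * g x)) k x"
        by (simp add: at_order_def)
    qed
  qed
qed

lemma qpoly_derivs_real_polynomial_times:
  assumes "real_polynomial_function q" "qpoly_derivs g"
  shows "qpoly_derivs (\<lambda>x. of_real (q x) * g x)"
  using assms
proof (induction arbitrary: g rule: real_polynomial_function.induct)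
  case (linear f)
  have f_eq: "f x = (\<Sum>i\<in>UNIV. (x $ i) * f (axis i 1))" for x
  proof -
    have "x = (\<Sum>i\<in>UNIV. (x $ i) *\<^sub>R axis i 1)"
      by (simp add: vec_eq_iff axis_def sum.delta if_distrib cong: if_cong)
    then have "f x = f (\<Sum>i\<in>UNIV. (x $ i) *\<^sub>R axis i 1)" by (rule arg_cong)
    also have "\<dots> = (\<Sum>i\<in>UNIV. (x $ i) * f (axis i 1))"
      using linear(1) by (simp add: linear_sum linear_cmul bounded_linear.linear)
    finally show ?thesis .
  qed
  have *: "(\<Sum>i\<in>UNIV. of_real (f (axis i 1)) * (coord i x * g x)) = of_real (f x) * g x" for x
    by (subst f_eq[of x]) (simp add: coord_def sum_distrib_left sum_distrib_right mult_ac)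
  have "qpoly_derivs (\<lambda>x. \<Sum>i\<in>UNIV. of_real (f (axis i 1)) * (coord i x * g x))"
    using linear(2) by (intro qpoly_derivs_sum qpoly_derivs_scale qpoly_derivs_coord_times)
  then show ?case unfolding * .
next
  case (const a)
  then show ?case by (rule qpoly_derivs_scale)
next
  case (add f h)
  from qpoly_derivs_add[OF add.IH(1)[OF add.prems] add.IH(2)[OF add.prems]] show ?case
    by (simp add: algebra_simps)
next
  case (mult f h)
  from mult.IH(1)[OF mult.IH(2)[OF mult.prems]] show ?case
    by (simp add: mult.assoc)
qed

lemma qpoly_polynomial:
  assumes "polynomial_function p"
  shows "qpoly (at_order 0 p)"
proof -
  have "qpoly_derivs (\<lambda>x. \<Sum>b\<in>Basis. b * (of_real (p x \<bullet> b) * 1))"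
    using assms unfolding polynomial_function_iff_Basis_inner
    by (intro qpoly_derivs_sum qpoly_derivs_scale qpoly_derivs_real_polynomial_times qpoly_derivs_one) auto
  moreover have "(\<Sum>b\<in>Basis. b * (of_real (p x \<bullet> b) * 1)) = p x" for x
    using euclidean_representation[of "p x"] by (simp add: scaleR_conv_of_real mult.commute)
  ultimately have "qpoly_derivs p" by simp
  then show ?thesis unfolding qpoly_derivs_def by (metis pds_Nil)
qed


section \<open>Density\<close>

lemma Ck_norm_pullback:
  assumes "K \<subseteq> chart_dom c"
  shows "Ck_norm c K l (pullback c G) =
    Sup (insert 0 (\<Union>is\<in>{is. length is \<le> l}. (\<lambda>p. norm (pds is G (chart_map c p))) ` K))"
proof -
  have "{norm (chart_derivs c is (pullback c G) p) | p is. p \<in> K \<and> length is \<le> l}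
      = {norm (pds is G (chart_map c p)) | p is. p \<in> K \<and> length is \<le> l}"
    using assms by (metis (no_types, lifting) chart_derivs_pullback subsetD)
  also have "\<dots> = (\<Union>is\<in>{is. length is \<le> l}. (\<lambda>p. norm (pds is G (chart_map c p))) ` K)"
    by blast
  finally have "{norm (chart_derivs c is (pullback c G) p) | p is. p \<in> K \<and> length is \<le> l} = \<dots>" .
  then show ?thesis by (simp add: Ck_norm_def)
qed

text \<open>Compactness enters here: the supremum of an unbounded set of reals has no meaning.\<close>

lemma Ck_norm_nonneg:
  assumes K: "compact K" "K \<subseteq> chart_dom c" and G: "smooth_on V G"
  shows "0 \<le> Ck_norm c K l (pullback c G)"
proof -
  have "compact (chart_map c ` K)"
    using K continuous_on_chart_map by (meson compact_continuous_image continuous_on_subset)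
  have "bdd_above ((\<lambda>p. norm (pds is G (chart_map c p))) ` K)" for "is"
  proof -
    have "continuous_on (chart_map c ` K) (pds is G)"
      using smooth_on_continuous[OF smooth_on_pds[OF G]] K(2) by (meson continuous_on_subset image_mono)
    then have "compact (pds is G ` (chart_map c ` K))"
      using \<open>compact (chart_map c ` K)\<close> by (rule compact_continuous_image)
    then obtain B where "\<forall>y\<in>pds is G ` (chart_map c ` K). norm y \<le> B"
      using compact_imp_bounded bounded_iff by blast
    then show ?thesis by (intro bdd_aboveI2[of _ _ B]) simp
  qed
  moreover have "finite {is :: 'm list. length is \<le> l}"
    using finite_lists_length_le[of "UNIV :: 'm set" l] by simp
  ultimately show ?thesis
    unfolding Ck_norm_pullback[OF K(2)] by (intro cSup_upper) auto
qed

lemma Ck_norm_le: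
  assumes "K \<subseteq> chart_dom c" "0 \<le> e"
    "\<And>is p. length is \<le> l \<Longrightarrow> p \<in> K \<Longrightarrow> norm (pds is G (chart_map c p)) \<le> e"
  shows "Ck_norm c K l (pullback c G) \<le> e"
  unfolding Ck_norm_pullback[OF assms(1)] by (rule cSup_least) (use assms in auto)

text \<open>
  The tail of the metric is small whatever the norms are, since each term is at most \<open>2\<close> to the power
  \<open>-k\<close>; so only the first \<open>N\<close> norms have to be controlled.
\<close>

lemma dist_on_le:
  assumes nonneg: "\<And>k. 0 \<le> hbar_norm c K k (\<lambda>i p. f i p - g i p)"
    and small: "\<And>k. k < N \<Longrightarrow> hbar_norm c K k (\<lambda>i p. f i p - g i p) \<le> e"
  shows "dist_on c K f g \<le> real N * e + 2 * (1 / 2) ^ N"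
proof -
  define a where "a k = hbar_norm c K k (\<lambda>i p. f i p - g i p)" for k
  define t where "t k = (1 / 2) ^ k * (a k / (1 + a k))" for k
  have a: "0 \<le> a k" for k using nonneg by (simp add: a_def)
  have t: "0 \<le> t k" "t k \<le> (1 / 2) ^ k" "t k \<le> a k" for k
  proof -
    have "0 \<le> a k / (1 + a k)" "a k / (1 + a k) \<le> 1" "a k / (1 + a k) \<le> a k"
      using a[of k] by (auto simp: divide_simps algebra_simps)
    moreover have "(1 / 2 :: real) ^ k \<le> 1" by (simp add: power_le_one)
    ultimately show "0 \<le> t k" "t k \<le> (1 / 2) ^ k" "t k \<le> a k"
      using mult_left_mono[of "a k / (1 + a k)" 1 "(1 / 2) ^ k"]
        mult_mono[of "(1 / 2) ^ k" 1 "a k / (1 + a k)" "a k"] a[of k]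
      by (auto simp: t_def)
  qed
  have geo: "summable (\<lambda>k. (1 / 2 :: real) ^ k)" by (rule summable_geometric) simp
  have sum_t: "summable t"
    by (rule summable_comparison_test'[OF geo, of 0]) (use t in auto)
  have "dist_on c K f g = (\<Sum>k. t (k + N)) + (\<Sum>k<N. t k)"
    unfolding dist_on_def t_def[symmetric] a_def[symmetric] by (rule suminf_split_initial_segment[OF sum_t])
  also have "(\<Sum>k<N. t k) \<le> real N * e"
  proof -
    have "t k \<le> e" if "k \<in> {..<N}" for k
      using order_trans[OF t(3) small[of k, folded a_def]] that by simp
    from sum_bounded_above[of "{..<N}" t, OF this] show ?thesis by simp
  qed
  also have "(\<Sum>k. t (k + N)) \<le> (\<Sum>k. (1 / 2) ^ (k + N))"
    by (intro suminf_le t(2) summable_ignore_initial_segment sum_t geo)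
  also have "(\<Sum>k. (1 / 2 :: real) ^ (k + N)) = 2 * (1 / 2) ^ N"
    using suminf_mult2[OF geo, of "(1 / 2) ^ N"] suminf_geometric[of "1 / 2 :: real"]
    by (simp add: power_add)
  finally show ?thesis by simp
qed

lemma quantum_polynomials_dense:
  assumes f: "f \<in> formal_smooth c" and K: "compact K" "K \<subseteq> chart_dom c" and "\<epsilon> > 0"
  shows "\<exists>p\<in>QP. dist_on c K f p < \<epsilon>"
proof -
  obtain F where F: "f = (\<lambda>k. pullback c (F k))" "\<And>k. smooth_on V (F k)"
    using f by (rule formal_smoothE) blast
  obtain N where N: "(1 / 2 :: real) ^ N < \<epsilon> / 4"
    using real_arch_pow_inv[of "\<epsilon> / 4" "1 / 2"] \<open>\<epsilon> > 0\<close> by auto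
  \<comment> \<open>\<open>N\<close> terms of the metric, each one a sum of at most \<open>N\<close> norms, share \<open>\<epsilon> / 2\<close>.\<close>
  define e where "e = \<epsilon> / (2 * (real N * real N + 1))"
  have pos: "2 * (real N * real N + 1) > 0" by (simp add: add_nonneg_pos)
  then have "e > 0" unfolding e_def by (rule divide_pos_pos[OF \<open>\<epsilon> > 0\<close>])
  moreover have "e * (2 * (real N * real N + 1)) = \<epsilon>" unfolding e_def using pos by simp
  then have "\<epsilon> = 2 * (real N * (real N * e)) + 2 * e" by (simp add: algebra_simps)
  ultimately have e: "e > 0" "real N * (real N * e) \<le> \<epsilon> / 2" by linarith+
  have K': "compact (chart_map c ` K)" "chart_map c ` K \<subseteq> V"
    using K continuous_on_chart_map by (meson compact_continuous_image continuous_on_subset image_mono)+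
  have "\<exists>p. polynomial_function p \<and> (\<forall>is x. length is \<le> N \<longrightarrow> x \<in> chart_map c ` K \<longrightarrow>
      norm (pds is (\<lambda>x. F k x - p x) x) \<le> e)" for k
  proof (rule polynomial_approx_derivatives[OF open_V F(2) K' e(1)])
    fix q assume q: "polynomial_function q" "\<And>is x. length is \<le> N \<Longrightarrow> x \<in> chart_map c ` K \<Longrightarrow>
      norm (pds is (\<lambda>x. F k x - q x) x) \<le> e"
    show ?thesis by (rule exI[of _ q]) (intro conjI allI impI q)
  qed
  then obtain p where p: "\<And>k. polynomial_function (p k)"
    "\<And>k is x. length is \<le> N \<Longrightarrow> x \<in> chart_map c ` K \<Longrightarrow> norm (pds is (\<lambda>x. F k x - p k x) x) \<le> e"
    by metis
  define Q where "Q k = (if k < N then p k else (\<lambda>x. 0))" for k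
  have "qpoly (\<lambda>k x. \<Sum>m<N. at_order m (p m) k x)"
    by (intro qpoly_sum qpoly_at_order[OF qpoly_polynomial] p(1))
  moreover have "(\<Sum>m<N. at_order m (p m) k x) = Q k x" for k x
  proof -
    have "(\<Sum>m<N. at_order m (p m) k x) = (\<Sum>m<N. if m = k then p m x else 0)"
      by (intro sum.cong refl) (auto simp: at_order_def)
    then show ?thesis by (simp add: Q_def sum.delta)
  qed
  ultimately have Q: "qpoly Q" by (simp add: qpoly_cong)
  define g where "g = (\<lambda>k. pullback c (Q k))"
  have diff: "(\<lambda>p. f i p - g i p) = pullback c (\<lambda>x. F i x - Q i x)" for i
    by (simp add: F(1) g_def pullback_def fun_eq_iff)
  have nonneg: "0 \<le> Ck_norm c K l (\<lambda>p. f i p - g i p)" for i l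
    unfolding diff by (intro Ck_norm_nonneg K smooth_on_diff open_V F(2) qpoly_smooth[OF Q])
  have small: "Ck_norm c K l (\<lambda>p. f i p - g i p) \<le> e" if "i < N" "l \<le> N" for i l
    unfolding diff using that p(2) K e(1) by (intro Ck_norm_le) (auto simp: Q_def)
  have "dist_on c K f g \<le> real N * (real N * e) + 2 * (1 / 2) ^ N"
  proof (rule dist_on_le)
    fix k
    show "0 \<le> hbar_norm c K k (\<lambda>i p. f i p - g i p)"
      unfolding hbar_norm_def using nonneg by (rule sum_nonneg)
    assume "k < N"
    then have "hbar_norm c K k (\<lambda>i p. f i p - g i p) \<le> real (Suc k) * e"
      unfolding hbar_norm_def using small sum_bounded_above[of "{..k}" _ e] by fastforce
    also have "\<dots> \<le> real N * e"
      using \<open>k < N\<close> e(1) by (intro mult_right_mono) auto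
    finally show "hbar_norm c K k (\<lambda>i p. f i p - g i p) \<le> real N * e" .
  qed
  also have "\<dots> < \<epsilon>" using N e(2) by simp
  finally show ?thesis using Q by (auto simp: qpoly_def g_def)
qed

end


section \<open>Quantum Darboux charts\<close>

lemma poisson_darboux:
  assumes "\<omega> c p = darboux_form"
  shows "poisson \<omega> c p = (darboux_form :: real ^ ('n::finite \<times> bool) ^ ('n \<times> bool))"
proof -
  let ?J = "darboux_form :: real ^ ('n \<times> bool) ^ ('n \<times> bool)"
  have "(\<Sum>k\<in>UNIV. ?J $ a $ k * ?J $ k $ b) = (if a = b then -1 else 0)" for a b
  proof -
    have "(\<Sum>k\<in>UNIV. ?J $ a $ k * ?J $ k $ b) =
        (\<Sum>k\<in>UNIV. if k = (fst a, \<not> snd a) then if a = b then -1 else 0 else 0)"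
    proof (rule sum.cong)
      show "?J $ a $ k * ?J $ k $ b = (if k = (fst a, \<not> snd a) then if a = b then -1 else 0 else 0)" for k
        unfolding darboux_form_def vec_lambda_beta prod_eq_iff
        by (cases "snd a"; cases "snd b"; cases "snd k") simp_all
    qed simp
    then show ?thesis by simp
  qed
  then have sq: "?J ** ?J = - mat 1"
    by (simp add: vec_eq_iff matrix_matrix_mult_def mat_def)
  have right: "?J ** (- ?J) = mat 1" and left: "(- ?J) ** ?J = mat 1"
    using sq by (simp_all add: vec_eq_iff matrix_matrix_mult_def sum_negf)
  have "matrix_inv ?J ** ?J = mat 1"
    unfolding matrix_inv_def
    by (rule someI2[where Q = "\<lambda>B. B ** ?J = mat 1" and a = "- ?J"]) (use left right in auto)
  then have "matrix_inv ?J ** ?J ** (- ?J) = - ?J" by simp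
  moreover have "matrix_inv ?J ** ?J ** (- ?J) = matrix_inv ?J ** mat 1"
    by (simp only: right flip: matrix_mul_assoc)
  ultimately have "matrix_inv ?J = - ?J" by (simp only: matrix_mul_rid)
  moreover have "transpose (- ?J) = ?J"
    by (auto simp: darboux_form_def transpose_def vec_eq_iff)
  ultimately show ?thesis by (simp add: poisson_def assms)
qed

theorem theorem3p8:
  fixes \<A> :: "('x::{t2_space,second_countable_topology}, 'n::finite \<times> bool) chart set"
    and \<omega> :: "('x, 'n \<times> bool) two_form"
    and \<Gamma> :: "('x, 'n \<times> bool) christoffel"
    and I :: "('x, 'n \<times> bool, 'k::{real_normed_field,euclidean_space}) weyl_form"
    and c :: "('x, 'n \<times> bool) chart"
  assumes "symplectic_manifold \<A> \<omega>"
    and "fedosov_connection \<A> \<omega> \<Gamma> I"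
    and "quantum_darboux_chart \<A> \<omega> \<Gamma> I c"
  shows "quantum_polynomials \<omega> \<Gamma> I c \<subseteq> quantizable_functions \<omega> \<Gamma> I c \<and>
    (\<forall>f\<in>formal_smooth c. \<forall>K \<epsilon>. compact K \<and> K \<subseteq> chart_dom c \<and> \<epsilon> > 0 \<longrightarrow>
       (\<exists>p\<in>quantum_polynomials \<omega> \<Gamma> I c. dist_on c K f p < \<epsilon>))"
proof -
  interpret flat_chart c \<omega> \<Gamma> I darboux_form
  proof
    show "is_chart c"
      using assms(1,3) by (auto simp: symplectic_manifold_def smooth_structure_def quantum_darboux_chart_def)
    show "fedosov_D \<omega> \<Gamma> I c a i p h M = chart_deriv c i (\<lambda>q. a q h M) p - y_deriv i (a p h) M"
      if "a \<in> weyl_sections c" "p \<in> chart_dom c" for a i p h M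
      using assms(3) that unfolding quantum_darboux_chart_def by blast
    show "poisson \<omega> c p = darboux_form" if "p \<in> chart_dom c" for p
      using assms(3) that by (intro poisson_darboux) (simp add: quantum_darboux_chart_def)
    have "darboux_form $ (undefined, False) $ (undefined, True) \<noteq>
        (darboux_form $ (undefined, True) $ (undefined, False) :: real)"
      by (simp add: darboux_form_def)
    then show "\<exists>i j :: 'n \<times> bool. darboux_form $ i $ j \<noteq> (darboux_form $ j $ i :: real)" by blast
  qed
  show ?thesis
    using quantum_polynomials_quantizable quantum_polynomials_dense by blast
qed

end
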